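(* There exist constants $c_{\rm gap},C_n>0$ such that for all integers $p\ge n\geq C_n$ the following holds. Suppose one observes $Y=[Y_1,\dots,Y_n]\in\mathbb{R}^{p\times n}$ with $Y_i=l_i\mu+Z_i$, $Z_i\overset{iid}{\sim}N(0,I_p)$, $1\le i\le n$, where $\mu\in\mathbb{R}^p$ and $l\in\{-1,1\}^n$ are unknown. Then $$\inf_{\tilde l}\ \sup_{\substack{\mu:\ \|\mu\|_2\le c_{\rm gap}(p/n)^{1/4}\\ l\in\{-1,1\}^n}}\mathbb{E}\,\mathcal M(\tilde l,l)\ge\frac18,$$ where the infimum is over all estimators $\tilde l\in\{-1,1\}^n$ based on $Y$.
   Context: The misclassification rate is $$\mathcal M(l,\hat l):=\frac1n\min_\pi\left|\{i:\ l_i\ne\pi(\hat l_i)\}\right|,$$ where the minimum is over the permutations $\pi$ of $\{-1,1\}$. *)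

theory Defs
  imports "HOL-Probability.Probability" "HOL-Combinatorics.Permutations"
begin

text \<open>
  The dimensions \<open>p\<close> and \<open>n\<close> are quantified inside the statement, so \<open>\<real>\<^sup>p\<close> is represented by the
  extensional functions on \<open>{..<p}\<close>, and a matrix in \<open>\<real>\<^bsup>p\<times>n\<^esup>\<close> by the function taking a column
  index \<open>i < n\<close> to its column, so that \<open>Y i j\<close> is the \<open>j\<close>-th coordinate of \<open>Y\<^sub>i\<close>.
\<close>

definition std_gaussian :: "nat \<Rightarrow> (nat \<Rightarrow> real) measure" where
  "std_gaussian p = (\<Pi>\<^sub>M j\<in>{..<p}. density lborel std_normal_density)"

definition noise_law :: "nat \<Rightarrow> nat \<Rightarrow> (nat \<Rightarrow> nat \<Rightarrow> real) measure" where
  "noise_law p n = (\<Pi>\<^sub>M i\<in>{..<n}. std_gaussian p)"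

definition sample_space :: "nat \<Rightarrow> nat \<Rightarrow> (nat \<Rightarrow> nat \<Rightarrow> real) measure" where
  "sample_space p n = (\<Pi>\<^sub>M i\<in>{..<n}. \<Pi>\<^sub>M j\<in>{..<p}. borel)"

definition observation ::
  "nat \<Rightarrow> nat \<Rightarrow> (nat \<Rightarrow> real) \<Rightarrow> (nat \<Rightarrow> real) \<Rightarrow> (nat \<Rightarrow> nat \<Rightarrow> real) \<Rightarrow> nat \<Rightarrow> nat \<Rightarrow> real" where
  "observation p n \<mu> l Z = (\<lambda>i\<in>{..<n}. \<lambda>j\<in>{..<p}. l i * \<mu> j + Z i j)"

definition observation_law ::
  "nat \<Rightarrow> nat \<Rightarrow> (nat \<Rightarrow> real) \<Rightarrow> (nat \<Rightarrow> real) \<Rightarrow> (nat \<Rightarrow> nat \<Rightarrow> real) measure" where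
  "observation_law p n \<mu> l = distr (noise_law p n) (sample_space p n) (observation p n \<mu> l)"

definition labelings :: "nat \<Rightarrow> (nat \<Rightarrow> real) set" where
  "labelings n = {..<n} \<rightarrow>\<^sub>E {-1, 1}"

definition estimators :: "nat \<Rightarrow> nat \<Rightarrow> ((nat \<Rightarrow> nat \<Rightarrow> real) \<Rightarrow> nat \<Rightarrow> real) set" where
  "estimators p n = measurable (sample_space p n) (count_space (labelings n))"

definition misclassification_rate :: "nat \<Rightarrow> (nat \<Rightarrow> real) \<Rightarrow> (nat \<Rightarrow> real) \<Rightarrow> real" where
  "misclassification_rate n l l' =
     1 / real n * real (Min ((\<lambda>\<pi>. card {i \<in> {..<n}. l i \<noteq> \<pi> (l' i)}) ` {\<pi>. \<pi> permutes {-1, 1}}))"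

definition risk ::
  "nat \<Rightarrow> nat \<Rightarrow> ((nat \<Rightarrow> nat \<Rightarrow> real) \<Rightarrow> nat \<Rightarrow> real) \<Rightarrow> (nat \<Rightarrow> real) \<Rightarrow> (nat \<Rightarrow> real) \<Rightarrow> real" where
  "risk p n est \<mu> l =
     (\<integral>Y. misclassification_rate n (est Y) l \<partial>observation_law p n \<mu> l)"

definition mean_vectors :: "nat \<Rightarrow> real \<Rightarrow> (nat \<Rightarrow> real) set" where
  "mean_vectors p r = {\<mu> \<in> {..<p} \<rightarrow>\<^sub>E UNIV. L2_set \<mu> {..<p} \<le> r}"

text \<open>
  For \<open>n \<ge> 1\<close> and \<open>r \<ge> 0\<close> the infimum and the supremum below range over nonempty sets, and the
  risk takes values in \<open>[0, 1]\<close>, so the real-valued \<open>Inf\<close> and \<open>Sup\<close> are the true ones.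
\<close>

definition minimax_risk :: "nat \<Rightarrow> nat \<Rightarrow> real \<Rightarrow> real" where
  "minimax_risk p n r =
     (INF est\<in>estimators p n. SUP (\<mu>, l)\<in>mean_vectors p r \<times> labelings n. risk p n est \<mu> l)"

end

theory Submission
  imports Defs
begin

text \<open>
  The supremum over means and labelings is at least the average over a prior, and the prior taken
  here is uniform: \<open>l\<close> is a uniform sign vector and \<open>\<mu> = a \<epsilon>\<close> for a uniform sign vector \<open>\<epsilon>\<close> of
  length \<open>p\<close>. With \<open>a = r / sqrt p\<close> every such mean lies on the sphere of radius \<open>r\<close>, and for
  \<open>r = (p / n) powr (1 / 4) / 4\<close> the relation \<open>a ^ 4 * p * n = 1 / 256\<close> holds. This quantity is the
  one that the argument has to keep small.

  Misclassification is reduced to pairs of indices. If \<open>m\<close> is the misclassification rate of the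
  estimate \<open>e\<close>, a pair \<open>(i, k)\<close> with \<open>e i * e k \<noteq> l i * l k\<close> contains an index that is wrong for
  the optimal relabeling, so at most \<open>2 * n\<^sup>2 * m\<close> ordered pairs are of this kind
  (\<open>pair_errors_le_misclassification\<close>). Hence it suffices that for \<open>i \<noteq> k\<close> the product \<open>l i * l k\<close> is
  hard to recover. Flipping the single label \<open>l k\<close> negates this product. If the laws of the data
  before and after the flip have densities at \<open>L\<^sup>1\<close> distance at most \<open>1 / 2\<close>, the two error
  probabilities add up to at least \<open>3 / 4\<close> (\<open>pair_error_lower_bound\<close>). Averaging over the
  labelings and the pairs gives a Bayes risk of at least \<open>3 * (n - 1) / (16 * n)\<close>, which is at
  least \<open>1 / 8\<close> from \<open>n = 3\<close> on.

  The flip is analysed after revealing all labels except the \<open>k\<close>-th. The other columns enter only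
  through \<open>u\<^sub>j = (\<Sum>i\<noteq>k. l i * Y i j)\<close>; given them, the signs \<open>\<epsilon> j\<close> are independent with posterior
  means \<open>tanh (a * u\<^sub>j)\<close>, and column \<open>k\<close> has a product density whose factors depend on
  \<open>t j = l k * tanh (a * u\<^sub>j)\<close> (\<open>marginal_likelihood_insert\<close>). The flip replaces \<open>t\<close> by \<open>- t\<close>. The
  inner products of these densities in \<open>L\<^sup>2\<close> of the standard Gaussian are explicit products over the
  coordinates, which bounds the distance in terms of \<open>a\<^sup>2 * (\<Sum>j<p. (t j)\<^sup>2)\<close>
  (\<open>posterior_predictive_L1_dist\<close>). Each \<open>(t j)\<^sup>2\<close> is at most of order \<open>a\<^sup>2 * n\<close> on average, so the final
  bound is of order \<open>a ^ 4 * p * n\<close>. The condition \<open>n \<le> p\<close> is what makes \<open>a\<^sup>2 * n\<close> bounded and so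
  keeps the exponential moments of \<open>a * u\<^sub>j\<close> close to their first-order expansion.
\<close>

section \<open>Gaussian location families\<close>

text \<open>
  Acting coordinatewise preserves independence, and densities of independent coordinates multiply.
  Both measures agree with the product of the transformed factors on boxes, which determine it. The
  lemma is applied twice: to the entries of a column, and to the columns of the data matrix.
\<close>

lemma distr_PiM_eq_density:
  fixes M :: "'i \<Rightarrow> 'a measure"
  assumes I: "finite I" and M: "\<And>i. prob_space (M i)"
    and f [measurable]: "\<And>i. f i \<in> M i \<rightarrow>\<^sub>M M i"
    and g [measurable]: "\<And>i. g i \<in> borel_measurable (M i)"
    and eq: "\<And>i. distr (M i) (M i) (f i) = density (M i) (g i)"
  shows "distr (PiM I M) (PiM I M) (\<lambda>x. \<lambda>i\<in>I. f i (x i)) = density (PiM I M) (\<lambda>x. \<Prod>i\<in>I. g i (x i))"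
proof -
  interpret M: product_prob_space M
    by (intro product_prob_spaceI M)
  define N where "N = (\<lambda>i. density (M i) (g i))"
  have sets_N: "sets (N i) = sets (M i)" for i
    by (simp add: N_def)
  have "prob_space (N i)" for i
    unfolding N_def eq[symmetric] by (intro prob_space.prob_space_distr M f)
  then interpret N: product_prob_space N
    by (intro product_prob_spaceI)
  have sets_PiM_N: "sets (PiM I M) = sets (PiM I N)"
    by (intro sets_PiM_cong) (auto simp: sets_N)
  have "distr (PiM I M) (PiM I M) (\<lambda>x. \<lambda>i\<in>I. f i (x i)) = PiM I N"
  proof (rule N.PiM_eqI[OF I])
    fix A assume "\<And>i. i \<in> I \<Longrightarrow> A i \<in> sets (N i)"
    then have A [measurable]: "\<And>i. i \<in> I \<Longrightarrow> A i \<in> sets (M i)"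
      by (simp add: sets_N)
    have "emeasure (distr (PiM I M) (PiM I M) (\<lambda>x. \<lambda>i\<in>I. f i (x i))) (Pi\<^sub>E I A) =
        emeasure (PiM I M) ((\<lambda>x. \<lambda>i\<in>I. f i (x i)) -` Pi\<^sub>E I A \<inter> space (PiM I M))"
      by (intro emeasure_distr sets_PiM_I_finite I A) measurable
    also have "(\<lambda>x. \<lambda>i\<in>I. f i (x i)) -` Pi\<^sub>E I A \<inter> space (PiM I M) =
        Pi\<^sub>E I (\<lambda>i. f i -` A i \<inter> space (M i))"
      by (auto simp: space_PiM PiE_iff)
    also have "emeasure (PiM I M) \<dots> = (\<Prod>i\<in>I. emeasure (M i) (f i -` A i \<inter> space (M i)))"
      using A by (intro M.emeasure_PiM I) measurable
    also have "\<dots> = (\<Prod>i\<in>I. emeasure (N i) (A i))"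
      unfolding N_def eq[symmetric] by (intro prod.cong refl emeasure_distr[symmetric] f A)
    finally show "emeasure (distr (PiM I M) (PiM I M) (\<lambda>x. \<lambda>i\<in>I. f i (x i))) (Pi\<^sub>E I A) =
        (\<Prod>i\<in>I. emeasure (N i) (A i))" .
  qed (simp add: sets_PiM_N)
  moreover have "density (PiM I M) (\<lambda>x. \<Prod>i\<in>I. g i (x i)) = PiM I N"
  proof (rule N.PiM_eqI[OF I])
    fix A assume "\<And>i. i \<in> I \<Longrightarrow> A i \<in> sets (N i)"
    then have A [measurable]: "\<And>i. i \<in> I \<Longrightarrow> A i \<in> sets (M i)"
      by (simp add: sets_N)
    have "emeasure (density (PiM I M) (\<lambda>x. \<Prod>i\<in>I. g i (x i))) (Pi\<^sub>E I A) =
        (\<integral>\<^sup>+x. (\<Prod>i\<in>I. g i (x i)) * indicator (Pi\<^sub>E I A) x \<partial>PiM I M)"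
      by (intro emeasure_density sets_PiM_I_finite I A) measurable
    also have "\<dots> = (\<integral>\<^sup>+x. (\<Prod>i\<in>I. g i (x i) * indicator (A i) (x i)) \<partial>PiM I M)"
    proof (intro nn_integral_cong)
      fix x assume "x \<in> space (PiM I M)"
      then have "indicator (Pi\<^sub>E I A) x = (\<Prod>i\<in>I. indicator (A i) (x i) :: ennreal)"
        using I by (cases "x \<in> Pi\<^sub>E I A") (auto simp: space_PiM PiE_iff indicator_def intro!: prod_zero[symmetric])
      then show "(\<Prod>i\<in>I. g i (x i)) * indicator (Pi\<^sub>E I A) x = (\<Prod>i\<in>I. g i (x i) * indicator (A i) (x i))"
        by (simp add: prod.distrib)
    qed
    also have "\<dots> = (\<Prod>i\<in>I. \<integral>\<^sup>+y. g i y * indicator (A i) y \<partial>M i)"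
      by (intro M.product_nn_integral_prod I) measurable
    also have "\<dots> = (\<Prod>i\<in>I. emeasure (N i) (A i))"
      unfolding N_def by (intro prod.cong refl emeasure_density[symmetric] g A)
    finally show "emeasure (density (PiM I M) (\<lambda>x. \<Prod>i\<in>I. g i (x i))) (Pi\<^sub>E I A) =
        (\<Prod>i\<in>I. emeasure (N i) (A i))" .
  qed (simp add: sets_PiM_N)
  ultimately show ?thesis by simp
qed

abbreviation std_normal :: "real measure" where
  "std_normal \<equiv> density lborel std_normal_density"

text \<open>
  The density of a standard Gaussian vector translated by \<open>v\<close>, relative to the untranslated one.
\<close>

definition tilt :: "nat \<Rightarrow> (nat \<Rightarrow> real) \<Rightarrow> (nat \<Rightarrow> real) \<Rightarrow> real" where
  "tilt p v y = exp (\<Sum>j<p. v j * y j - (v j)\<^sup>2 / 2)"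

text \<open>
  The set \<open>I\<close> of observed columns is a parameter because the argument conditions on all columns
  but one.
\<close>

definition likelihood ::
  "nat \<Rightarrow> nat set \<Rightarrow> (nat \<Rightarrow> real) \<Rightarrow> (nat \<Rightarrow> real) \<Rightarrow> (nat \<Rightarrow> nat \<Rightarrow> real) \<Rightarrow> real" where
  "likelihood p I \<mu> l Y = (\<Prod>i\<in>I. tilt p (\<lambda>j. l i * \<mu> j) (Y i))"

lemma prob_space_std_gaussian: "prob_space (std_gaussian p)"
  unfolding std_gaussian_def
  by (intro prob_space_PiM prob_space_normal_density) simp

lemma distr_std_normal_shift:
  "distr std_normal std_normal (\<lambda>z. v + z) = density std_normal (\<lambda>z. ennreal (exp (v * z - v\<^sup>2 / 2)))"
proof -
  interpret prob_space std_normal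
    by (rule prob_space_normal_density) simp
  have "distributed std_normal lborel (\<lambda>x. x) std_normal_density"
    by (auto simp: distributed_def intro!: measure_eqI simp: emeasure_distr)
  from normal_density_affine[OF this, of 1 v]
  have "distr std_normal lborel (\<lambda>z. v + z) = density lborel (normal_density v 1)"
    by (simp add: distributed_distr_eq_density)
  also have "\<dots> = density lborel (\<lambda>z. ennreal (std_normal_density z) * ennreal (exp (v * z - v\<^sup>2 / 2)))"
    by (intro density_cong)
      (auto simp: normal_density_def ennreal_mult'[symmetric] exp_add[symmetric] power2_eq_square field_simps)
  also have "\<dots> = density std_normal (\<lambda>z. ennreal (exp (v * z - v\<^sup>2 / 2)))"
    by (subst density_density_eq) auto
  also have "distr std_normal lborel (\<lambda>z. v + z) = distr std_normal std_normal (\<lambda>z. v + z)"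
    by (intro distr_cong) auto
  finally show ?thesis .
qed

lemma distr_std_gaussian_shift:
  "distr (std_gaussian p) (std_gaussian p) (\<lambda>z. \<lambda>j\<in>{..<p}. v j + z j) =
   density (std_gaussian p) (\<lambda>y. ennreal (tilt p v y))"
proof -
  have "distr (std_gaussian p) (std_gaussian p) (\<lambda>z. \<lambda>j\<in>{..<p}. v j + z j) =
     density (std_gaussian p) (\<lambda>y. \<Prod>j<p. ennreal (exp (v j * y j - (v j)\<^sup>2 / 2)))"
    unfolding std_gaussian_def
    by (intro distr_PiM_eq_density distr_std_normal_shift)
      (auto intro: prob_space_normal_density)
  then show ?thesis
    by (simp add: tilt_def exp_sum prod_ennreal)
qed

lemma measurable_tilt [measurable]: "tilt p v \<in> borel_measurable (std_gaussian p)"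
proof -
  have "(\<lambda>y. exp (\<Sum>j<p. v j * y j - (v j)\<^sup>2 / 2)) \<in> borel_measurable (PiM {..<p} (\<lambda>_. std_normal))"
    by measurable
  then show ?thesis by (simp add: tilt_def[abs_def] std_gaussian_def)
qed

lemma sets_noise_law: "sets (noise_law p n) = sets (sample_space p n)"
  unfolding noise_law_def sample_space_def std_gaussian_def
  by (intro sets_PiM_cong refl) simp

lemma observation_law_eq_density:
  "observation_law p n \<mu> l = density (noise_law p n) (\<lambda>Y. ennreal (likelihood p {..<n} \<mu> l Y))"
proof -
  have "observation_law p n \<mu> l =
      distr (noise_law p n) (noise_law p n) (\<lambda>Z. \<lambda>i\<in>{..<n}. \<lambda>j\<in>{..<p}. l i * \<mu> j + Z i j)"
    unfolding observation_law_def observation_def by (intro distr_cong) (simp_all add: sets_noise_law)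
  also have "\<dots> = density (noise_law p n) (\<lambda>Y. \<Prod>i<n. ennreal (tilt p (\<lambda>j. l i * \<mu> j) (Y i)))"
    unfolding noise_law_def
  proof (rule distr_PiM_eq_density[where f="\<lambda>i z. \<lambda>j\<in>{..<p}. l i * \<mu> j + z j"])
    show "(\<lambda>z. \<lambda>j\<in>{..<p}. l i * \<mu> j + z j) \<in> std_gaussian p \<rightarrow>\<^sub>M std_gaussian p" for i
      unfolding std_gaussian_def by measurable
  qed (auto simp: prob_space_std_gaussian distr_std_gaussian_shift)
  also have "\<dots> = density (noise_law p n) (\<lambda>Y. ennreal (likelihood p {..<n} \<mu> l Y))"
    by (simp add: likelihood_def prod_ennreal tilt_def)
  finally show ?thesis .
qed

section \<open>Gaussian exponential moments\<close>

lemma (in product_sigma_finite) has_bochner_integral_PiM_prod: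
  fixes f :: "'i \<Rightarrow> 'a \<Rightarrow> real"
  assumes "finite I" "\<And>i. i \<in> I \<Longrightarrow> has_bochner_integral (M i) (f i) (v i)"
  shows "has_bochner_integral (PiM I M) (\<lambda>x. \<Prod>i\<in>I. f i (x i)) (\<Prod>i\<in>I. v i)"
  using assms product_integrable_prod[of I f] product_integral_prod[of I f]
  by (simp add: has_bochner_integral_iff)

lemma product_prob_space_std_normal: "product_prob_space (\<lambda>_. std_normal)"
  by (intro product_prob_spaceI prob_space_normal_density) simp

lemma product_prob_space_std_gaussian: "product_prob_space (\<lambda>_. std_gaussian p)"
  by (intro product_prob_spaceI prob_space_std_gaussian)

text \<open>
  The density of the law translated by \<open>c\<close> has total mass one; this is the moment generating
  function after rescaling.
\<close>

lemma std_normal_mgf: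
  "has_bochner_integral std_normal (\<lambda>z. exp (c * z)) (exp (c\<^sup>2 / 2))"
proof -
  interpret prob_space std_normal
    by (rule prob_space_normal_density) simp
  have "prob_space (distr std_normal std_normal (\<lambda>z. c + z))"
    by (rule prob_space_distr) measurable
  then have "emeasure (density std_normal (\<lambda>z. ennreal (exp (c * z - c\<^sup>2 / 2)))) UNIV = 1"
    unfolding distr_std_normal_shift using prob_space.emeasure_space_1 by fastforce
  then have "(\<integral>\<^sup>+z. ennreal (exp (c * z - c\<^sup>2 / 2)) \<partial>std_normal) = ennreal 1"
    by (subst (asm) emeasure_density) auto
  then have "has_bochner_integral std_normal (\<lambda>z. exp (c * z - c\<^sup>2 / 2)) 1"
    by (intro has_bochner_integral_nn_integral) auto
  from has_bochner_integral_mult_left[OF this, of "exp (c\<^sup>2 / 2)"]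
  show ?thesis by (simp add: exp_add[symmetric] mult.commute)
qed

text \<open>
  All expectations under the prior mixture below are sums of integrals of this form.
\<close>

lemma gaussian_matrix_mgf:
  fixes c :: "'i \<Rightarrow> nat \<Rightarrow> real"
  assumes "finite I"
  shows "has_bochner_integral (PiM I (\<lambda>_. std_gaussian p))
    (\<lambda>x. exp (\<Sum>i\<in>I. \<Sum>j<p. c i j * x i j)) (exp (\<Sum>i\<in>I. \<Sum>j<p. (c i j)\<^sup>2 / 2))"
proof -
  interpret N: product_prob_space "\<lambda>_. std_normal" "{..<p}"
    by (rule product_prob_space_std_normal)
  interpret G: product_prob_space "\<lambda>_. std_gaussian p" I
    by (rule product_prob_space_std_gaussian)
  have "has_bochner_integral (std_gaussian p)
      (\<lambda>y. \<Prod>j<p. exp (c i j * y j)) (\<Prod>j<p. exp ((c i j)\<^sup>2 / 2))" for i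
    unfolding std_gaussian_def
    by (rule N.has_bochner_integral_PiM_prod[where f="\<lambda>j z. exp (c i j * z)"]) (simp_all add: std_normal_mgf)
  from G.has_bochner_integral_PiM_prod[OF assms this]
  show ?thesis by (simp add: exp_sum assms)
qed

section \<open>The predictive law of one column\<close>

text \<open>
  If the signs \<open>\<epsilon> j\<close> are independent with means \<open>t j\<close>, this is the density of \<open>a \<epsilon> + Z\<close> relative to
  the standard Gaussian vector \<open>Z\<close>: averaging \<open>exp (a * e * y - a\<^sup>2 / 2)\<close> over a sign \<open>e\<close> with mean
  \<open>t\<close> gives \<open>exp (- a\<^sup>2 / 2) * (cosh (a * y) + t * sinh (a * y))\<close>.
\<close>

definition posterior_predictive :: "nat \<Rightarrow> real \<Rightarrow> (nat \<Rightarrow> real) \<Rightarrow> (nat \<Rightarrow> real) \<Rightarrow> real" where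
  "posterior_predictive p a t y =
     (\<Prod>j<p. exp (- a\<^sup>2 / 2) * (cosh (a * y j) + t j * sinh (a * y j)))"

lemma posterior_predictive_integral:
  "has_bochner_integral (std_gaussian p) (posterior_predictive p a t) 1"
proof -
  interpret N: product_prob_space "\<lambda>_. std_normal" "{..<p}"
    by (rule product_prob_space_std_normal)
  have "has_bochner_integral std_normal
      (\<lambda>z. exp (- a\<^sup>2 / 2) * (cosh (a * z) + s * sinh (a * z))) 1" for s
  proof -
    have "has_bochner_integral std_normal
        (\<lambda>z. (exp (- a\<^sup>2 / 2) * (1 + s) / 2) * exp (a * z) + (exp (- a\<^sup>2 / 2) * (1 - s) / 2) * exp ((- a) * z))
        ((exp (- a\<^sup>2 / 2) * (1 + s) / 2) * exp (a\<^sup>2 / 2) + (exp (- a\<^sup>2 / 2) * (1 - s) / 2) * exp ((- a)\<^sup>2 / 2))"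
      by (intro has_bochner_integral_add has_bochner_integral_mult_right std_normal_mgf)
    also have "(exp (- a\<^sup>2 / 2) * (1 + s) / 2) * exp (a\<^sup>2 / 2) + (exp (- a\<^sup>2 / 2) * (1 - s) / 2) * exp ((- a)\<^sup>2 / 2)
        = exp (- a\<^sup>2 / 2) * exp (a\<^sup>2 / 2)"
      by (simp add: field_simps)
    also have "\<dots> = 1" by (simp add: exp_add[symmetric])
    finally show ?thesis
      by (simp add: cosh_def sinh_def field_simps)
  qed
  then have "has_bochner_integral (std_gaussian p)
      (\<lambda>y. \<Prod>j<p. exp (- a\<^sup>2 / 2) * (cosh (a * y j) + t j * sinh (a * y j))) (\<Prod>j<p. 1)"
    unfolding std_gaussian_def by (intro N.has_bochner_integral_PiM_prod) auto
  then show ?thesis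
    by (simp add: posterior_predictive_def[abs_def])
qed

text \<open>
  In one coordinate the product of the two factors is a combination of \<open>exp (2 * a * z)\<close>,
  \<open>exp (- 2 * a * z)\<close> and a constant, whose Gaussian integrals are known. Only the product \<open>s * s'\<close>
  of the two means survives integration, since the mixed terms are odd in \<open>z\<close>.
\<close>

lemma posterior_predictive_overlap:
  "has_bochner_integral (std_gaussian p)
     (\<lambda>y. posterior_predictive p a t y * posterior_predictive p a t' y)
     (\<Prod>j<p. cosh (a\<^sup>2) + t j * t' j * sinh (a\<^sup>2))"
proof -
  interpret N: product_prob_space "\<lambda>_. std_normal" "{..<p}"
    by (rule product_prob_space_std_normal)
  have "has_bochner_integral std_normal
      (\<lambda>z. exp (- a\<^sup>2 / 2) * (cosh (a * z) + s * sinh (a * z)) *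
        (exp (- a\<^sup>2 / 2) * (cosh (a * z) + s' * sinh (a * z))))
      (cosh (a\<^sup>2) + s * s' * sinh (a\<^sup>2))" for s s'
  proof -
    let ?e = "exp (- a\<^sup>2)"
    have "has_bochner_integral std_normal
        (\<lambda>z. (?e * (1 + s) * (1 + s') / 4) * exp (2 * a * z) + (?e * (1 - s) * (1 - s') / 4) * exp ((- 2 * a) * z)
           + (?e * (1 - s * s') / 2) * exp (0 * z))
        ((?e * (1 + s) * (1 + s') / 4) * exp ((2 * a)\<^sup>2 / 2) + (?e * (1 - s) * (1 - s') / 4) * exp ((- 2 * a)\<^sup>2 / 2)
           + (?e * (1 - s * s') / 2) * exp (0\<^sup>2 / 2))" (is "has_bochner_integral _ ?f ?v")
      by (intro has_bochner_integral_add has_bochner_integral_mult_right std_normal_mgf)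
    also have "?v = (1 + s * s') / 2 * (?e * exp (2 * a\<^sup>2)) + (1 - s * s') / 2 * ?e"
      by (simp add: field_simps power2_eq_square)
    also have "?e * exp (2 * a\<^sup>2) = exp (a\<^sup>2)"
      by (simp add: exp_add[symmetric])
    also have "(1 + s * s') / 2 * exp (a\<^sup>2) + (1 - s * s') / 2 * ?e = cosh (a\<^sup>2) + s * s' * sinh (a\<^sup>2)"
      by (simp add: cosh_def sinh_def field_simps)
    also have "?f = (\<lambda>z. exp (- a\<^sup>2 / 2) * (cosh (a * z) + s * sinh (a * z)) *
        (exp (- a\<^sup>2 / 2) * (cosh (a * z) + s' * sinh (a * z))))"
    proof
      fix z
      have e: "?e = exp (- a\<^sup>2 / 2) * exp (- a\<^sup>2 / 2)"
        by (simp add: exp_add[symmetric])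
      have e2: "exp (2 * a * z) = exp (a * z) * exp (a * z)" "exp (- 2 * a * z) = exp (- (a * z)) * exp (- (a * z))"
        by (simp_all add: exp_add[symmetric])
      have e3: "exp (a * z) * exp (- (a * z)) = 1"
        by (simp add: exp_add[symmetric])
      have alg: "(E * E * (1 + s) * (1 + s') / 4) * (P * P) + (E * E * (1 - s) * (1 - s') / 4) * (Q * Q)
           + (E * E * (1 - s * s') / 2) * (P * Q) =
           E * ((P + Q) / 2 + s * ((P - Q) / 2)) * (E * ((P + Q) / 2 + s' * ((P - Q) / 2)))" for E P Q :: real
        by (simp add: field_simps)
      show "?f z = exp (- a\<^sup>2 / 2) * (cosh (a * z) + s * sinh (a * z)) *
        (exp (- a\<^sup>2 / 2) * (cosh (a * z) + s' * sinh (a * z)))"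
        unfolding e e2 cosh_field_def sinh_field_def
        using alg[of "exp (- a\<^sup>2 / 2)" "exp (a * z)" "exp (- (a * z))"] unfolding e3 by simp
    qed
    finally show ?thesis .
  qed
  then have "has_bochner_integral (std_gaussian p)
      (\<lambda>y. \<Prod>j<p. exp (- a\<^sup>2 / 2) * (cosh (a * y j) + t j * sinh (a * y j)) *
        (exp (- a\<^sup>2 / 2) * (cosh (a * y j) + t' j * sinh (a * y j))))
      (\<Prod>j<p. cosh (a\<^sup>2) + t j * t' j * sinh (a\<^sup>2))"
    unfolding std_gaussian_def by (intro N.has_bochner_integral_PiM_prod) auto
  then show ?thesis
    by (simp add: posterior_predictive_def prod.distrib)
qed

lemma one_minus_sum_le_prod:
  fixes x :: "'i \<Rightarrow> real"
  assumes "finite I" "\<And>i. i \<in> I \<Longrightarrow> 0 \<le> x i" "\<And>i. i \<in> I \<Longrightarrow> x i \<le> 1"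
  shows "1 - (\<Sum>i\<in>I. x i) \<le> (\<Prod>i\<in>I. 1 - x i)"
  using assms
proof (induction I rule: finite_induct)
  case (insert i I)
  have "(\<Prod>i\<in>I. 1 - x i) \<le> 1"
    using insert by (intro prod_le_1) auto
  then have "x i * (\<Prod>i\<in>I. 1 - x i) \<le> x i * 1"
    using insert.prems by (intro mult_left_mono) auto
  then show ?case
    using insert by (simp add: algebra_simps)
qed simp

text \<open>
  Write \<open>A\<close>, \<open>B\<close> for the two densities and put \<open>C = cosh (a\<^sup>2)\<close>, \<open>S = sinh (a\<^sup>2)\<close>. By the overlap
  formula \<open>\<integral>(A - B)\<^sup>2\<close> is twice the difference of the products of \<open>C + (t j)\<^sup>2 * S\<close> and of
  \<open>C - (t j)\<^sup>2 * S\<close>. After division by \<open>C ^ p\<close> the first is at most \<open>exp (S * X)\<close> and the second at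
  least \<open>1 - S * X\<close>, where \<open>X\<close> is the sum of the \<open>(t j)\<^sup>2\<close>. For \<open>S * X \<le> 1\<close> the difference is
  therefore linear in \<open>S * X\<close> up to a constant; for \<open>S * X > 1\<close> the claim exceeds the trivial bound
  \<open>2\<close>. A bound linear in \<open>X\<close> is wanted because \<open>X\<close> is random in the application and only its mean
  is available. This is why \<open>\<bar>A - B\<bar> \<le> 1 / 4 + (A - B)\<^sup>2\<close> is used in place of the Cauchy-Schwarz
  inequality, which would produce a square root.
\<close>

lemma posterior_predictive_L1_dist:
  assumes t: "\<And>j. j < p \<Longrightarrow> \<bar>t j\<bar> \<le> 1"
  shows "(\<integral>\<^sup>+y. ennreal \<bar>posterior_predictive p a t y - posterior_predictive p a (\<lambda>j. - t j) y\<bar> \<partial>std_gaussian p)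
    \<le> ennreal (1 / 4 + 6 * cosh (a\<^sup>2) ^ p * sinh (a\<^sup>2) * (\<Sum>j<p. (t j)\<^sup>2))"
proof -
  interpret G: prob_space "std_gaussian p" by (rule prob_space_std_gaussian)
  define A where "A = posterior_predictive p a t"
  define B where "B = posterior_predictive p a (\<lambda>j. - t j)"
  define C where "C = cosh (a\<^sup>2)"
  define S where "S = sinh (a\<^sup>2)"
  define X where "X = (\<Sum>j<p. (t j)\<^sup>2)"
  have C: "C \<ge> 1" and S: "0 \<le> S" "S \<le> C"
    by (auto simp: C_def S_def cosh_real_ge_1 sinh_le_cosh_real)
  have X: "X \<ge> 0" by (simp add: X_def sum_nonneg)
  have Cp: "C ^ p \<ge> 1" using C by (rule one_le_power)
  have int_A: "has_bochner_integral (std_gaussian p) A 1"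
    and int_B: "has_bochner_integral (std_gaussian p) B 1"
    by (simp_all add: A_def B_def posterior_predictive_integral)
  have pos: "cosh z + s * sinh z \<ge> 0" if "\<bar>s\<bar> \<le> 1" for s z :: real
  proof -
    have "\<bar>s * sinh z\<bar> \<le> 1 * \<bar>sinh z\<bar>"
      unfolding abs_mult using that by (intro mult_right_mono) auto
    also have "\<bar>sinh z\<bar> \<le> cosh z"
      using sinh_le_cosh_real[of z] sinh_le_cosh_real[of "-z"] by auto
    finally show ?thesis by linarith
  qed
  have "0 \<le> posterior_predictive p a s y" if "\<And>j. j < p \<Longrightarrow> \<bar>s j\<bar> \<le> 1" for s y
    unfolding posterior_predictive_def
    using that by (intro prod_nonneg ballI mult_nonneg_nonneg pos) auto
  then have nonneg: "0 \<le> A y" "0 \<le> B y" for y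
    unfolding A_def B_def using t by simp_all
  have "integral\<^sup>L (std_gaussian p) (\<lambda>y. \<bar>A y - B y\<bar>) \<le> 1 / 4 + 6 * C ^ p * S * X"
  proof (cases "S * X \<le> 1")
    case False
    have "integral\<^sup>L (std_gaussian p) (\<lambda>y. \<bar>A y - B y\<bar>) \<le> integral\<^sup>L (std_gaussian p) (\<lambda>y. A y + B y)"
      using int_A int_B nonneg
      by (intro integral_mono) (auto simp: has_bochner_integral_iff abs_le_iff add_increasing add_increasing2)
    also have "\<dots> = 2"
      using int_A int_B by (simp add: has_bochner_integral_iff)
    also have "\<dots> \<le> 6 * (1 * 1)" by simp
    also have "\<dots> \<le> 6 * (C ^ p * (S * X))"
      using False Cp by (intro mult_left_mono mult_mono) auto
    finally show ?thesis by (simp add: mult.assoc)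
  next
    case True
    have sq: "has_bochner_integral (std_gaussian p) (\<lambda>y. (A y * A y + B y * B y) - 2 * (A y * B y))
       (((\<Prod>j<p. C + t j * t j * S) + (\<Prod>j<p. C + - t j * - t j * S)) - 2 * (\<Prod>j<p. C + t j * - t j * S))"
      unfolding A_def B_def C_def S_def
      by (intro has_bochner_integral_diff has_bochner_integral_add has_bochner_integral_mult_right
            posterior_predictive_overlap)
    have upper: "(\<Prod>j<p. C + t j * t j * S) \<le> C ^ p * exp (S * X)"
    proof -
      have "(\<Prod>j<p. C + t j * t j * S) \<le> (\<Prod>j<p. C * exp (S * (t j)\<^sup>2))"
      proof (intro prod_mono conjI)
        fix j
        have "C + t j * t j * S \<le> C + C * (S * (t j)\<^sup>2)"
          using C S mult_right_mono[of 1 C "S * (t j)\<^sup>2"] by (simp add: power2_eq_square mult_ac)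
        also have "\<dots> = C * (1 + S * (t j)\<^sup>2)" by (simp add: algebra_simps)
        also have "\<dots> \<le> C * exp (S * (t j)\<^sup>2)"
          using C by (intro mult_left_mono) auto
        finally show "C + t j * t j * S \<le> C * exp (S * (t j)\<^sup>2)" .
        show "0 \<le> C + t j * t j * S" using C S by simp
      qed
      then show ?thesis
        by (simp add: prod.distrib exp_sum[symmetric] sum_distrib_left X_def)
    qed
    have lower: "C ^ p * (1 - S * X) \<le> (\<Prod>j<p. C + t j * - t j * S)"
    proof -
      have "1 - S * X \<le> 1 - (\<Sum>j<p. S / C * (t j)\<^sup>2)"
      proof -
        have "S / C * X \<le> S * X"
          using C S X mult_left_mono[of 1 C S] by (intro mult_right_mono) (auto simp: divide_le_eq)
        then show ?thesis by (simp add: X_def sum_distrib_left)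
      qed
      also have "\<dots> \<le> (\<Prod>j<p. 1 - S / C * (t j)\<^sup>2)"
      proof (intro one_minus_sum_le_prod)
        fix j assume "j \<in> {..<p}"
        then have "(t j)\<^sup>2 \<le> 1" using t by (simp add: abs_square_le_1)
        then show "S / C * (t j)\<^sup>2 \<le> 1"
          using C S by (intro mult_le_one) auto
      qed (use C S in auto)
      finally have "C ^ p * (1 - S * X) \<le> C ^ p * (\<Prod>j<p. 1 - S / C * (t j)\<^sup>2)"
        using Cp by (intro mult_left_mono) auto
      also have "\<dots> = (\<Prod>j<p. C * (1 - S / C * (t j)\<^sup>2))"
        by (simp add: prod.distrib)
      also have "\<dots> = (\<Prod>j<p. C + t j * - t j * S)"
        using C by (intro prod.cong) (auto simp: field_simps power2_eq_square)
      finally show ?thesis .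
    qed
    have "exp (S * X) \<le> 1 + S * X + (S * X)\<^sup>2"
      using True S X by (intro exp_bound) auto
    also have "(S * X)\<^sup>2 \<le> S * X"
      using True S X by (simp add: power2_eq_square mult_left_le)
    finally have "C ^ p * (exp (S * X) - (1 - S * X)) \<le> C ^ p * (3 * (S * X))"
      using Cp by (intro mult_left_mono) auto
    with upper lower have D: "((\<Prod>j<p. C + t j * t j * S) + (\<Prod>j<p. C + - t j * - t j * S)) - 2 * (\<Prod>j<p. C + t j * - t j * S)
        \<le> 6 * C ^ p * S * X"
      by (simp add: algebra_simps)
    have "integral\<^sup>L (std_gaussian p) (\<lambda>y. \<bar>A y - B y\<bar>) \<le>
        integral\<^sup>L (std_gaussian p) (\<lambda>y. 1 / 4 + ((A y * A y + B y * B y) - 2 * (A y * B y)))"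
    proof (rule integral_mono)
      fix y
      \<comment> \<open>The square is chosen to produce \<open>\<bar>A y - B y\<bar> \<le> 1 / 4 + (A y - B y)\<^sup>2\<close>.\<close>
      have "0 \<le> (\<bar>A y - B y\<bar> - 1 / 2)\<^sup>2" by simp
      also have "\<dots> = (A y - B y)\<^sup>2 - \<bar>A y - B y\<bar> + 1 / 4"
        by (simp add: power2_diff power_divide)
      finally show "\<bar>A y - B y\<bar> \<le> 1 / 4 + ((A y * A y + B y * B y) - 2 * (A y * B y))"
        by (simp add: power2_eq_square algebra_simps)
    qed (use int_A int_B sq in \<open>auto simp only: has_bochner_integral_iff
          intro!: integrable_abs Bochner_Integration.integrable_diff Bochner_Integration.integrable_add G.integrable_const\<close>)
    also have "\<dots> = 1 / 4 + integral\<^sup>L (std_gaussian p) (\<lambda>y. (A y * A y + B y * B y) - 2 * (A y * B y))"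
      using sq by (subst Bochner_Integration.integral_add) (auto simp: has_bochner_integral_iff G.prob_space)
    also have "\<dots> \<le> 1 / 4 + 6 * C ^ p * S * X"
      using D sq by (simp add: has_bochner_integral_iff)
    finally show ?thesis .
  qed
  moreover have "integrable (std_gaussian p) (\<lambda>y. \<bar>A y - B y\<bar>)"
    using int_A int_B by (auto simp: has_bochner_integral_iff)
  ultimately show ?thesis
    unfolding A_def[symmetric] B_def[symmetric] C_def[symmetric] S_def[symmetric] X_def[symmetric]
    by (subst nn_integral_eq_integral) (auto intro: ennreal_leI)
qed

section \<open>Averaging over the sign pattern of the mean\<close>

text \<open>
  The likelihood of the columns in \<open>I\<close> given their labels, averaged over the means \<open>a \<epsilon>\<close> with a
  uniform sign vector \<open>\<epsilon>\<close>. Sign vectors of length \<open>p\<close> have the same encoding as labelings of \<open>p\<close>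
  points.
\<close>

definition marginal_likelihood ::
  "nat \<Rightarrow> nat set \<Rightarrow> real \<Rightarrow> (nat \<Rightarrow> real) \<Rightarrow> (nat \<Rightarrow> nat \<Rightarrow> real) \<Rightarrow> real" where
  "marginal_likelihood p I a l Y =
     (\<Sum>\<epsilon>\<in>labelings p. likelihood p I (\<lambda>j. a * \<epsilon> j) l Y) / 2 ^ p"

text \<open>
  For known labels this is a sufficient statistic for the \<open>j\<close>-th coordinate of the mean.
\<close>

definition label_score :: "nat set \<Rightarrow> (nat \<Rightarrow> real) \<Rightarrow> (nat \<Rightarrow> nat \<Rightarrow> real) \<Rightarrow> nat \<Rightarrow> real" where
  "label_score I l Y j = (\<Sum>i\<in>I. l i * Y i j)"

lemma card_labelings: "card (labelings n) = 2 ^ n"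
proof -
  have "card {-1, 1::real} = 2" by simp
  then show ?thesis
    unfolding labelings_def by (simp only: card_PiE finite_lessThan prod_constant card_lessThan)
qed

lemma labelings_sign: "l \<in> labelings n \<Longrightarrow> i < n \<Longrightarrow> l i \<in> {-1, 1}"
  by (simp add: labelings_def PiE_iff)

lemma likelihood_eq_exp:
  assumes I: "finite I" "\<And>i. i \<in> I \<Longrightarrow> l i \<in> {-1, 1}" and \<epsilon>: "\<epsilon> \<in> labelings p"
  shows "likelihood p I (\<lambda>j. a * \<epsilon> j) l Y =
    exp (- a\<^sup>2 / 2 * real p * real (card I)) * exp (\<Sum>i\<in>I. \<Sum>j<p. a * l i * \<epsilon> j * Y i j)"
proof -
  have "(l i * (a * \<epsilon> j))\<^sup>2 = a\<^sup>2" if "i \<in> I" "j < p" for i j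
    using I(2)[OF that(1)] labelings_sign[OF \<epsilon> that(2)] by (auto simp: power_mult_distrib)
  then have "likelihood p I (\<lambda>j. a * \<epsilon> j) l Y =
      (\<Prod>i\<in>I. exp (\<Sum>j<p. l i * (a * \<epsilon> j) * Y i j - a\<^sup>2 / 2))"
    by (simp add: likelihood_def tilt_def)
  also have "\<dots> = exp ((\<Sum>i\<in>I. \<Sum>j<p. l i * (a * \<epsilon> j) * Y i j) - a\<^sup>2 / 2 * real p * real (card I))"
    by (simp add: exp_sum[OF I(1), symmetric] sum_subtractf mult_ac)
  finally show ?thesis
    unfolding exp_add[symmetric] by (simp add: mult_ac)
qed

text \<open>
  The likelihood factorizes over the coordinates with \<open>\<epsilon> j\<close> occurring in the \<open>j\<close>-th factor only, so
  the average over all sign vectors is a product of averages over a single sign.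
\<close>

lemma marginal_likelihood_eq:
  assumes I: "finite I" "\<And>i. i \<in> I \<Longrightarrow> l i \<in> {-1, 1}"
  shows "marginal_likelihood p I a l Y =
    (\<Prod>j<p. exp (- a\<^sup>2 / 2 * real (card I)) * cosh (a * label_score I l Y j))"
proof -
  have "likelihood p I (\<lambda>j. a * \<epsilon> j) l Y =
      (\<Prod>j<p. exp (- a\<^sup>2 / 2 * real (card I)) * exp (\<epsilon> j * (a * label_score I l Y j)))"
    if "\<epsilon> \<in> labelings p" for \<epsilon>
  proof -
    have "(\<Sum>i\<in>I. \<Sum>j<p. a * l i * \<epsilon> j * Y i j) = (\<Sum>j<p. \<Sum>i\<in>I. a * l i * \<epsilon> j * Y i j)"
      by (rule sum.swap)
    also have "\<dots> = (\<Sum>j<p. \<epsilon> j * (a * label_score I l Y j))"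
      unfolding label_score_def sum_distrib_left by (intro sum.cong refl) (simp only: mult_ac)
    finally have S: "(\<Sum>i\<in>I. \<Sum>j<p. a * l i * \<epsilon> j * Y i j) = (\<Sum>j<p. \<epsilon> j * (a * label_score I l Y j))" .
    have "likelihood p I (\<lambda>j. a * \<epsilon> j) l Y =
        exp (- a\<^sup>2 / 2 * real p * real (card I)) * exp (\<Sum>i\<in>I. \<Sum>j<p. a * l i * \<epsilon> j * Y i j)"
      using I that by (rule likelihood_eq_exp)
    also have "\<dots> = exp (real p * (- a\<^sup>2 / 2 * real (card I))) * exp (\<Sum>j<p. \<epsilon> j * (a * label_score I l Y j))"
      unfolding S by (simp only: mult_ac)
    finally show ?thesis
      unfolding exp_of_nat_mult exp_sum[OF finite_lessThan]
      by (simp only: prod.distrib prod_constant card_lessThan)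
  qed
  then have "(\<Sum>\<epsilon>\<in>labelings p. likelihood p I (\<lambda>j. a * \<epsilon> j) l Y) =
      (\<Sum>\<epsilon>\<in>{..<p} \<rightarrow>\<^sub>E {-1, 1}. \<Prod>j<p. exp (- a\<^sup>2 / 2 * real (card I)) * exp (\<epsilon> j * (a * label_score I l Y j)))"
    unfolding labelings_def[symmetric] by (intro sum.cong refl)
  also have "\<dots> = (\<Prod>j<p. \<Sum>e\<in>{-1, 1}. exp (- a\<^sup>2 / 2 * real (card I)) * exp (e * (a * label_score I l Y j)))"
    by (subst prod_sum_PiE) auto
  also have "\<dots> = (\<Prod>j<p. 2 * (exp (- a\<^sup>2 / 2 * real (card I)) * cosh (a * label_score I l Y j)))"
    by (intro prod.cong refl) (simp add: cosh_def distrib_left)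
  finally show ?thesis
    by (simp add: marginal_likelihood_def prod.distrib)
qed

text \<open>
  Bayes' rule for revealing one more column: the addition theorem splits
  \<open>cosh (a * u\<^sub>j + a * l k * y j)\<close> into \<open>cosh (a * u\<^sub>j)\<close>, which belongs to the old columns, and a factor
  of the predictive density with posterior mean \<open>l k * tanh (a * u\<^sub>j)\<close>.
\<close>

lemma marginal_likelihood_insert:
  assumes I: "finite I" "k \<notin> I" "\<And>i. i \<in> insert k I \<Longrightarrow> l i \<in> {-1, 1}"
  shows "marginal_likelihood p (insert k I) a l (Y(k := y)) =
    marginal_likelihood p I a l Y *
    posterior_predictive p a (\<lambda>j. l k * tanh (a * label_score I l Y j)) y"
proof -
  have score: "label_score (insert k I) l (Y(k := y)) j = label_score I l Y j + l k * y j" for j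
  proof -
    have "(\<Sum>i\<in>I. l i * (Y(k := y)) i j) = (\<Sum>i\<in>I. l i * Y i j)"
      using I(2) by (intro sum.cong) auto
    then show ?thesis
      using I by (simp add: label_score_def)
  qed
  have cosh_eq: "cosh (u + a * (l k * v)) = cosh u * (cosh (a * v) + l k * tanh u * sinh (a * v))" for u v
    using I(3)[of k] by (auto simp: cosh_add cosh_diff tanh_def field_simps)
  have card_eq: "exp (- a\<^sup>2 / 2 * real (card (insert k I))) = exp (- a\<^sup>2 / 2 * real (card I)) * exp (- a\<^sup>2 / 2)"
    using I by (simp add: exp_add[symmetric] algebra_simps)
  have "exp (- a\<^sup>2 / 2 * real (card (insert k I))) * cosh (a * label_score (insert k I) l (Y(k := y)) j) =
      (exp (- a\<^sup>2 / 2 * real (card I)) * cosh (a * label_score I l Y j)) *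
      (exp (- a\<^sup>2 / 2) * (cosh (a * y j) + l k * tanh (a * label_score I l Y j) * sinh (a * y j)))" for j
    unfolding score distrib_left[of a] card_eq cosh_eq by (simp only: mult_ac)
  moreover have "marginal_likelihood p (insert k I) a l (Y(k := y)) =
      (\<Prod>j<p. exp (- a\<^sup>2 / 2 * real (card (insert k I))) * cosh (a * label_score (insert k I) l (Y(k := y)) j))"
    "marginal_likelihood p I a l Y = (\<Prod>j<p. exp (- a\<^sup>2 / 2 * real (card I)) * cosh (a * label_score I l Y j))"
    using I by (simp_all only: finite_insert marginal_likelihood_eq insertI2)
  ultimately show ?thesis
    by (simp only: posterior_predictive_def prod.distrib[symmetric])
qed

lemma marginal_likelihood_nonneg: "0 \<le> marginal_likelihood p I a l Y"
  by (auto simp: marginal_likelihood_def likelihood_def tilt_def intro!: divide_nonneg_nonneg sum_nonneg prod_nonneg)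

text \<open>
  The factor \<open>exp (\<sigma> * a * u\<^sub>m)\<close> shifts \<open>\<epsilon> m\<close> by \<open>\<sigma>\<close> in the exponent of the likelihood, so the integral is
  again a Gaussian moment generating function.
\<close>

lemma likelihood_exp_score:
  assumes I: "finite I" "\<And>i. i \<in> I \<Longrightarrow> l i \<in> {-1, 1}" and \<epsilon>: "\<epsilon> \<in> labelings p" and m: "m < p"
  shows "has_bochner_integral (PiM I (\<lambda>_. std_gaussian p))
    (\<lambda>Y. likelihood p I (\<lambda>j. a * \<epsilon> j) l Y * exp (\<sigma> * (a * label_score I l Y m)))
    (exp (a\<^sup>2 * real (card I) * (\<sigma>\<^sup>2 / 2 + \<sigma> * \<epsilon> m)))"
proof -
  define c where "c i j = a * l i * (\<epsilon> j + (if j = m then \<sigma> else 0))" for i j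
  let ?w = "exp (- a\<^sup>2 / 2 * real p * real (card I))"
  have "has_bochner_integral (PiM I (\<lambda>_. std_gaussian p))
      (\<lambda>Y. ?w * exp (\<Sum>i\<in>I. \<Sum>j<p. c i j * Y i j)) (?w * exp (\<Sum>i\<in>I. \<Sum>j<p. (c i j)\<^sup>2 / 2))"
    by (intro has_bochner_integral_mult_right gaussian_matrix_mgf I)
  also have "(\<lambda>Y. ?w * exp (\<Sum>i\<in>I. \<Sum>j<p. c i j * Y i j)) =
      (\<lambda>Y. likelihood p I (\<lambda>j. a * \<epsilon> j) l Y * exp (\<sigma> * (a * label_score I l Y m)))"
  proof
    fix Y
    have "(\<Sum>j<p. c i j * Y i j) = (\<Sum>j<p. a * l i * \<epsilon> j * Y i j) + \<sigma> * (a * (l i * Y i m))" for i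
    proof -
      have "(\<Sum>j<p. c i j * Y i j) =
          (\<Sum>j<p. a * l i * \<epsilon> j * Y i j + (if j = m then \<sigma> * (a * (l i * Y i j)) else 0))"
        by (intro sum.cong) (auto simp: c_def algebra_simps)
      then show ?thesis using m by (simp add: sum.distrib)
    qed
    moreover have L: "likelihood p I (\<lambda>j. a * \<epsilon> j) l Y = ?w * exp (\<Sum>i\<in>I. \<Sum>j<p. a * l i * \<epsilon> j * Y i j)"
      using I \<epsilon> by (rule likelihood_eq_exp)
    ultimately show "?w * exp (\<Sum>i\<in>I. \<Sum>j<p. c i j * Y i j) =
        likelihood p I (\<lambda>j. a * \<epsilon> j) l Y * exp (\<sigma> * (a * label_score I l Y m))"
      unfolding L
      by (simp add: label_score_def sum.distrib sum_distrib_left exp_add)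
  qed
  also have "?w * exp (\<Sum>i\<in>I. \<Sum>j<p. (c i j)\<^sup>2 / 2) = exp (a\<^sup>2 * real (card I) * (\<sigma>\<^sup>2 / 2 + \<sigma> * \<epsilon> m))"
  proof -
    have "(\<Sum>j<p. (c i j)\<^sup>2 / 2) = a\<^sup>2 / 2 * real p + a\<^sup>2 * (\<sigma>\<^sup>2 / 2 + \<sigma> * \<epsilon> m)" if "i \<in> I" for i
    proof -
      have "(\<Sum>j<p. (c i j)\<^sup>2 / 2) =
          (\<Sum>j<p. a\<^sup>2 / 2 + (if j = m then a\<^sup>2 * (\<sigma>\<^sup>2 / 2 + \<sigma> * \<epsilon> m) else 0))"
      proof (intro sum.cong refl)
        fix j assume "j \<in> {..<p}"
        then have "\<epsilon> j \<in> {-1, 1}" using labelings_sign[OF \<epsilon>] by simp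
        then show "(c i j)\<^sup>2 / 2 = a\<^sup>2 / 2 + (if j = m then a\<^sup>2 * (\<sigma>\<^sup>2 / 2 + \<sigma> * \<epsilon> m) else 0)"
          using I(2)[OF that] by (cases "j = m") (auto simp: c_def power2_eq_square algebra_simps)
      qed
      then show ?thesis using m by (simp add: sum.distrib)
    qed
    then show ?thesis
      by (simp add: exp_add[symmetric] algebra_simps)
  qed
  finally show ?thesis .
qed

text \<open>
  This replaces the second moment of the posterior mean: \<open>(tanh x)\<^sup>2\<close> is at most \<open>2 * (cosh x - 1)\<close>
  by \<open>tanh_square_le\<close>, and unlike \<open>tanh\<close> the hyperbolic cosine of the score integrates exactly. For
  small \<open>b\<close> the value is \<open>b\<close> to first order. It is the same for every \<open>\<epsilon>\<close> because the cosine is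
  even, so averaging over \<open>\<epsilon>\<close> does not change it.
\<close>

lemma marginal_likelihood_cosh_score:
  fixes a :: real
  assumes I: "finite I" "\<And>i. i \<in> I \<Longrightarrow> l i \<in> {-1, 1}" and m: "m < p"
  defines "b \<equiv> a\<^sup>2 * real (card I)"
  shows "has_bochner_integral (PiM I (\<lambda>_. std_gaussian p))
    (\<lambda>Y. marginal_likelihood p I a l Y * (2 * (cosh (a * label_score I l Y m) - 1)))
    (2 * (exp (b / 2) * cosh b - 1))"
proof -
  have "has_bochner_integral (PiM I (\<lambda>_. std_gaussian p))
    (\<lambda>Y. likelihood p I (\<lambda>j. a * \<epsilon> j) l Y * (2 * (cosh (a * label_score I l Y m) - 1)))
    (2 * (exp (b / 2) * cosh b - 1))" if \<epsilon>: "\<epsilon> \<in> labelings p" for \<epsilon>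
  proof -
    let ?L = "\<lambda>\<sigma> Y. likelihood p I (\<lambda>j. a * \<epsilon> j) l Y * exp (\<sigma> * (a * label_score I l Y m))"
    have "has_bochner_integral (PiM I (\<lambda>_. std_gaussian p)) (\<lambda>Y. ?L 1 Y + ?L (-1) Y - 2 * ?L 0 Y)
      (exp (b * (1\<^sup>2 / 2 + 1 * \<epsilon> m)) + exp (b * ((-1)\<^sup>2 / 2 + (-1) * \<epsilon> m)) - 2 * exp (b * (0\<^sup>2 / 2 + 0 * \<epsilon> m)))"
      unfolding b_def
      by (intro has_bochner_integral_add has_bochner_integral_diff has_bochner_integral_mult_right
          likelihood_exp_score I \<epsilon> m)
    also have "(\<lambda>Y. ?L 1 Y + ?L (-1) Y - 2 * ?L 0 Y) =
        (\<lambda>Y. likelihood p I (\<lambda>j. a * \<epsilon> j) l Y * (2 * (cosh (a * label_score I l Y m) - 1)))"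
      by (intro ext) (simp add: cosh_def algebra_simps)
    also have "exp (b * (1\<^sup>2 / 2 + 1 * \<epsilon> m)) + exp (b * ((-1)\<^sup>2 / 2 + (-1) * \<epsilon> m)) - 2 * exp (b * (0\<^sup>2 / 2 + 0 * \<epsilon> m)) =
        2 * (exp (b / 2) * cosh b - 1)"
      using labelings_sign[OF \<epsilon> m] by (auto simp: cosh_def algebra_simps exp_add[symmetric])
    finally show ?thesis .
  qed
  then have "has_bochner_integral (PiM I (\<lambda>_. std_gaussian p))
    (\<lambda>Y. (\<Sum>\<epsilon>\<in>labelings p. likelihood p I (\<lambda>j. a * \<epsilon> j) l Y * (2 * (cosh (a * label_score I l Y m) - 1))) / 2 ^ p)
    ((\<Sum>\<epsilon>\<in>labelings p. 2 * (exp (b / 2) * cosh b - 1)) / 2 ^ p)"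
    by (intro has_bochner_integral_divide has_bochner_integral_sum) auto
  then show ?thesis
    by (simp add: marginal_likelihood_def sum_distrib_right card_labelings)
qed

lemma likelihood_integral:
  assumes I: "finite I" "\<And>i. i \<in> I \<Longrightarrow> l i \<in> {-1, 1}" and \<epsilon>: "\<epsilon> \<in> labelings p"
  shows "has_bochner_integral (PiM I (\<lambda>_. std_gaussian p)) (likelihood p I (\<lambda>j. a * \<epsilon> j) l) 1"
proof -
  have "(\<Sum>i\<in>I. \<Sum>j<p. (a * l i * \<epsilon> j)\<^sup>2 / 2) = (\<Sum>i\<in>I. \<Sum>j<p. a\<^sup>2 / 2)"
    using I(2) labelings_sign[OF \<epsilon>] by (intro sum.cong refl) (force simp: power_mult_distrib)
  then have sq: "exp (\<Sum>i\<in>I. \<Sum>j<p. (a * l i * \<epsilon> j)\<^sup>2 / 2) = exp (a\<^sup>2 / 2 * real p * real (card I))"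
    by (simp add: mult_ac)
  have L: "likelihood p I (\<lambda>j. a * \<epsilon> j) l Y =
      exp (- a\<^sup>2 / 2 * real p * real (card I)) * exp (\<Sum>i\<in>I. \<Sum>j<p. a * l i * \<epsilon> j * Y i j)" for Y
    using I \<epsilon> by (rule likelihood_eq_exp)
  show ?thesis
    using has_bochner_integral_mult_right[OF gaussian_matrix_mgf[OF I(1), of p "\<lambda>i j. a * l i * \<epsilon> j"],
        of "exp (- a\<^sup>2 / 2 * real p * real (card I))"]
    unfolding sq by (simp add: L[abs_def] exp_add[symmetric])
qed

lemma marginal_likelihood_integral:
  assumes I: "finite I" "\<And>i. i \<in> I \<Longrightarrow> l i \<in> {-1, 1}"
  shows "has_bochner_integral (PiM I (\<lambda>_. std_gaussian p)) (marginal_likelihood p I a l) 1"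
proof -
  have "has_bochner_integral (PiM I (\<lambda>_. std_gaussian p))
    (\<lambda>Y. (\<Sum>\<epsilon>\<in>labelings p. likelihood p I (\<lambda>j. a * \<epsilon> j) l Y) / 2 ^ p)
    ((\<Sum>\<epsilon>\<in>labelings p. 1) / 2 ^ p)"
    by (intro has_bochner_integral_divide has_bochner_integral_sum likelihood_integral I)
  then show ?thesis
    by (simp add: marginal_likelihood_def[abs_def] card_labelings)
qed

lemma tanh_square_le: "(tanh x)\<^sup>2 \<le> 2 * (cosh x - 1)" for x :: real
proof -
  have c: "1 \<le> cosh x" by (rule cosh_real_ge_1)
  have "(cosh x - 1) * (cosh x + 1) \<le> (cosh x - 1) * (2 * (cosh x)\<^sup>2)"
  proof (intro mult_left_mono)
    have "cosh x * 1 \<le> cosh x * cosh x" using c by (intro mult_left_mono) auto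
    then show "cosh x + 1 \<le> 2 * (cosh x)\<^sup>2" unfolding power2_eq_square using c by linarith
  qed (use c in simp)
  then have "(cosh x - 1) * (cosh x + 1) / (cosh x)\<^sup>2 \<le> 2 * (cosh x - 1)"
    by (subst pos_divide_le_eq) (auto simp only: mult_ac zero_less_power cosh_real_pos)
  moreover have "(sinh x)\<^sup>2 = (cosh x - 1) * (cosh x + 1)"
    using cosh_square_eq[of x] by (simp add: power2_eq_square algebra_simps)
  ultimately show ?thesis
    by (simp add: tanh_def power_divide)
qed

text \<open>
  Integrating first over column \<open>k\<close> leaves the marginal likelihood of the other columns times the
  distance between the two predictive densities. That distance is linear in the sum of squared
  posterior means, whose average under the marginal likelihood is controlled by
  \<open>marginal_likelihood_cosh_score\<close>.
\<close>

lemma marginal_likelihood_flip_L1_dist: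
  fixes a :: real
  assumes I: "finite I" "k \<notin> I" "\<And>i. i \<in> insert k I \<Longrightarrow> l i \<in> {-1, 1}"
  defines "b \<equiv> a\<^sup>2 * real (card I)"
  shows "(\<integral>\<^sup>+Y. ennreal \<bar>marginal_likelihood p (insert k I) a l Y -
           marginal_likelihood p (insert k I) a (l(k := - l k)) Y\<bar> \<partial>PiM (insert k I) (\<lambda>_. std_gaussian p))
    \<le> ennreal (1 / 4 + 6 * cosh (a\<^sup>2) ^ p * sinh (a\<^sup>2) * (real p * (2 * (exp (b / 2) * cosh b - 1))))"
proof -
  let ?G = "std_gaussian p"
  interpret G: product_prob_space "\<lambda>_. std_gaussian p" I
    by (rule product_prob_space_std_gaussian)
  define W where "W = marginal_likelihood p I a l"
  define u where "u Y j = a * label_score I l Y j" for Y j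
  define l' where "l' = l(k := - l k)"
  have l': "l' i \<in> {-1, 1}" if "i \<in> insert k I" for i
    using I(3)[OF that] I(3)[of k] by (auto simp: l'_def)
  have [measurable]: "marginal_likelihood p (insert k I) a l \<in> borel_measurable (PiM (insert k I) (\<lambda>_. ?G))"
    "marginal_likelihood p (insert k I) a l' \<in> borel_measurable (PiM (insert k I) (\<lambda>_. ?G))"
    using marginal_likelihood_integral[of "insert k I" l p a] marginal_likelihood_integral[of "insert k I" l' p a] I l'
    by (auto simp: has_bochner_integral_iff)
  have [measurable]: "posterior_predictive p a t \<in> borel_measurable ?G" for t
    using posterior_predictive_integral[of p a t] by (simp add: has_bochner_integral_iff borel_measurable_integrable)
  define K where "K = 6 * cosh (a\<^sup>2) ^ p * sinh (a\<^sup>2)"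
  have K: "K \<ge> 0" by (simp add: K_def)
  have score_l': "label_score I l' = label_score I l"
    using I(2) by (auto simp: label_score_def l'_def fun_eq_iff intro!: sum.cong)
  have W': "marginal_likelihood p I a l' = W"
    using I l' by (auto simp: W_def fun_eq_iff marginal_likelihood_eq score_l')
  have step: "(\<integral>\<^sup>+y. ennreal \<bar>marginal_likelihood p (insert k I) a l (Y(k := y)) -
          marginal_likelihood p (insert k I) a l' (Y(k := y))\<bar> \<partial>?G)
        \<le> ennreal (1 / 4 * W Y + K * (\<Sum>j<p. W Y * (2 * (cosh (u Y j) - 1))))" for Y
  proof -
    let ?t = "\<lambda>j. l k * tanh (u Y j)"
    have W: "0 \<le> W Y" unfolding W_def by (rule marginal_likelihood_nonneg)
    have t2: "(?t j)\<^sup>2 \<le> 2 * (cosh (u Y j) - 1)" for j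
      using I(3)[of k] tanh_square_le[of "u Y j"] by (auto simp: power_mult_distrib)
    have t1: "\<bar>?t j\<bar> \<le> 1" for j
      using I(3)[of k] tanh_real_lt_1[of "u Y j"] tanh_real_gt_neg1[of "u Y j"] by (auto simp: abs_mult)
    have "marginal_likelihood p (insert k I) a l (Y(k := y)) -
          marginal_likelihood p (insert k I) a l' (Y(k := y)) =
        W Y * (posterior_predictive p a ?t y - posterior_predictive p a (\<lambda>j. - ?t j) y)" for y
    proof -
      have "marginal_likelihood p (insert k I) a l (Y(k := y)) = marginal_likelihood p I a l Y *
          posterior_predictive p a (\<lambda>j. l k * tanh (a * label_score I l Y j)) y"
        using I by (rule marginal_likelihood_insert)
      moreover have "marginal_likelihood p (insert k I) a l' (Y(k := y)) = marginal_likelihood p I a l' Y *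
          posterior_predictive p a (\<lambda>j. l' k * tanh (a * label_score I l' Y j)) y"
        using I(1,2) l' by (rule marginal_likelihood_insert)
      moreover have "l' k = - l k" by (simp add: l'_def)
      ultimately show ?thesis
        by (simp add: W' score_l' W_def[symmetric] u_def right_diff_distrib)
    qed
    then have "(\<integral>\<^sup>+y. ennreal \<bar>marginal_likelihood p (insert k I) a l (Y(k := y)) -
          marginal_likelihood p (insert k I) a l' (Y(k := y))\<bar> \<partial>?G) =
        (\<integral>\<^sup>+y. ennreal (W Y) * ennreal \<bar>posterior_predictive p a ?t y - posterior_predictive p a (\<lambda>j. - ?t j) y\<bar> \<partial>?G)"
      using W by (simp add: abs_mult ennreal_mult)
    also have "\<dots> = ennreal (W Y) * (\<integral>\<^sup>+y. ennreal \<bar>posterior_predictive p a ?t y - posterior_predictive p a (\<lambda>j. - ?t j) y\<bar> \<partial>?G)"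
      by (intro nn_integral_cmult) measurable
    also have "\<dots> \<le> ennreal (W Y) * ennreal (1 / 4 + K * (\<Sum>j<p. (?t j)\<^sup>2))"
      unfolding K_def by (intro mult_left_mono posterior_predictive_L1_dist t1) auto
    also have "\<dots> \<le> ennreal (W Y) * ennreal (1 / 4 + K * (\<Sum>j<p. 2 * (cosh (u Y j) - 1)))"
      using K t2 by (intro mult_left_mono ennreal_leI add_left_mono sum_mono) auto
    also have "\<dots> = ennreal (1 / 4 * W Y + K * (\<Sum>j<p. W Y * (2 * (cosh (u Y j) - 1))))"
      using W by (subst ennreal_mult'[symmetric]) (simp_all add: algebra_simps sum_distrib_left)
    finally show ?thesis .
  qed
  have int: "has_bochner_integral (PiM I (\<lambda>_. ?G))
      (\<lambda>Y. 1 / 4 * W Y + K * (\<Sum>j<p. W Y * (2 * (cosh (u Y j) - 1))))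
      (1 / 4 * 1 + K * (\<Sum>j<p. 2 * (exp (b / 2) * cosh b - 1)))"
    unfolding W_def u_def b_def using I
    by (intro has_bochner_integral_add has_bochner_integral_mult_right has_bochner_integral_sum
        marginal_likelihood_integral marginal_likelihood_cosh_score) auto
  have "(\<integral>\<^sup>+Y. ennreal \<bar>marginal_likelihood p (insert k I) a l Y - marginal_likelihood p (insert k I) a l' Y\<bar>
        \<partial>PiM (insert k I) (\<lambda>_. ?G)) =
      (\<integral>\<^sup>+Y. \<integral>\<^sup>+y. ennreal \<bar>marginal_likelihood p (insert k I) a l (Y(k := y)) -
          marginal_likelihood p (insert k I) a l' (Y(k := y))\<bar> \<partial>?G \<partial>PiM I (\<lambda>_. ?G))"
    by (intro G.product_nn_integral_insert I) measurable
  also have "\<dots> \<le> (\<integral>\<^sup>+Y. ennreal (1 / 4 * W Y + K * (\<Sum>j<p. W Y * (2 * (cosh (u Y j) - 1)))) \<partial>PiM I (\<lambda>_. ?G))"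
    by (intro nn_integral_mono step)
  also have "\<dots> = ennreal (1 / 4 * 1 + K * (\<Sum>j<p. 2 * (exp (b / 2) * cosh b - 1)))"
  proof (subst nn_integral_eq_integral)
    show "AE Y in PiM I (\<lambda>_. ?G). 0 \<le> 1 / 4 * W Y + K * (\<Sum>j<p. W Y * (2 * (cosh (u Y j) - 1)))"
      using K by (auto intro!: add_nonneg_nonneg mult_nonneg_nonneg sum_nonneg AE_I2
          simp: W_def marginal_likelihood_nonneg cosh_real_ge_1)
  qed (use int in \<open>simp_all add: has_bochner_integral_iff\<close>)
  finally show ?thesis
    by (simp add: l'_def K_def mult.assoc)
qed

section \<open>Misclassification and pairs of labels\<close>

lemma misclassification_rate_bounds:
  "0 \<le> misclassification_rate n l l'" "misclassification_rate n l l' \<le> 1"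
proof -
  let ?N = "(\<lambda>\<pi>. card {i \<in> {..<n}. l i \<noteq> \<pi> (l' i)}) ` {\<pi>. \<pi> permutes {-1, 1::real}}"
  have "finite ?N" by (intro finite_imageI finite_permutations) simp
  then have "Min ?N \<le> card {i \<in> {..<n}. l i \<noteq> id (l' i)}"
    by (intro Min_le imageI CollectI permutes_id)
  also have "\<dots> \<le> card {..<n}" by (intro card_mono) auto
  finally have "Min ?N \<le> n" by simp
  then show "misclassification_rate n l l' \<le> 1"
    unfolding misclassification_rate_def by (cases "n = 0") (auto simp: field_simps)
  show "0 \<le> misclassification_rate n l l'"
    unfolding misclassification_rate_def by simp
qed

text \<open>
  The two permutations of the signs are the multiplications by \<open>1\<close> and by \<open>-1\<close>; products of two
  labels are therefore insensitive to relabeling.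
\<close>

lemma permutes_signs:
  assumes "\<pi> permutes {-1, 1::real}" "x \<in> {-1, 1}"
  shows "\<pi> x = \<pi> 1 * x" "\<pi> 1 \<in> {-1, 1}"
proof -
  have "\<pi> 1 \<in> {-1, 1}" "\<pi> (-1) \<in> {-1, 1}"
    by (simp_all only: permutes_in_image[OF assms(1)]) simp_all
  moreover have "\<pi> 1 \<noteq> \<pi> (-1)"
    using injD[OF permutes_inj[OF assms(1)], of 1 "-1"] by auto
  ultimately show "\<pi> x = \<pi> 1 * x" "\<pi> 1 \<in> {-1, 1}"
    using assms(2) by auto
qed

text \<open>
  Fix the optimal relabeling, which multiplies all labels by a sign \<open>s\<close>. If neither \<open>i\<close> nor \<open>k\<close> is
  misclassified, \<open>e i * e k = s * l i * s * l k = l i * l k\<close>. So every pair in error has a misclassified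
  first or second component, and each misclassified index serves \<open>n\<close> pairs in either position.
\<close>

lemma pair_errors_le_misclassification:
  assumes l: "\<And>i. i < n \<Longrightarrow> l i \<in> {-1, 1}" and e: "\<And>i. i < n \<Longrightarrow> e i \<in> {-1, 1}"
  shows "(\<Sum>i<n. \<Sum>k<n. of_bool (e i * e k \<noteq> l i * l k)) \<le>
    2 * (real n)\<^sup>2 * misclassification_rate n e l"
proof -
  let ?S = "\<lambda>\<pi>. {i \<in> {..<n}. e i \<noteq> \<pi> (l i)}"
  let ?N = "(\<lambda>\<pi>. card (?S \<pi>)) ` {\<pi>. \<pi> permutes {-1, 1::real}}"
  have "Min ?N \<in> ?N"
    by (intro Min_in finite_imageI finite_permutations) (auto intro: permutes_id)
  then obtain \<pi> where \<pi>: "\<pi> permutes {-1, 1::real}" and Min: "Min ?N = card (?S \<pi>)"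
    by auto
  define s where "s = \<pi> 1"
  have s: "s \<in> {-1, 1}"
    unfolding s_def by (rule permutes_signs(2)[OF \<pi>, of 1]) simp
  have \<pi>_eq: "\<pi> (l i) = s * l i" if "i < n" for i
    unfolding s_def by (rule permutes_signs(1)[OF \<pi> l[OF that]])
  have pt: "of_bool (e i * e k \<noteq> l i * l k) \<le>
      (of_bool (i \<in> ?S \<pi>) + of_bool (k \<in> ?S \<pi>) :: real)" if "i < n" "k < n" for i k
  proof -
    have "of_bool (x * y \<noteq> u * v) \<le> (of_bool (x \<noteq> s * u) + of_bool (y \<noteq> s * v) :: real)"
      if "u \<in> {-1, 1}" "v \<in> {-1, 1}" "x \<in> {-1, 1}" "y \<in> {-1, 1}" for u v x y :: real
      using s that by auto
    then show ?thesis
      using that l[OF that(1)] l[OF that(2)] e[OF that(1)] e[OF that(2)] by (simp add: \<pi>_eq)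
  qed
  have card: "(\<Sum>i<n. of_bool (i \<in> ?S \<pi>)) = real (card (?S \<pi>))"
  proof -
    have "(\<Sum>i<n. of_bool (i \<in> ?S \<pi>) :: real) = (\<Sum>i\<in>?S \<pi>. 1)"
      by (intro sum.mono_neutral_cong_right) auto
    then show ?thesis by simp
  qed
  have "(\<Sum>i<n. \<Sum>k<n. of_bool (e i * e k \<noteq> l i * l k)) \<le>
      (\<Sum>i<n. \<Sum>k<n. of_bool (i \<in> ?S \<pi>) + of_bool (k \<in> ?S \<pi>) :: real)"
    by (intro sum_mono pt) auto
  also have "\<dots> = 2 * real n * real (card (?S \<pi>))"
    by (simp only: sum.distrib sum_constant card card_lessThan sum_distrib_left[symmetric])
  also have "\<dots> = 2 * (real n)\<^sup>2 * misclassification_rate n e l"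
    unfolding misclassification_rate_def Min by (simp add: power2_eq_square)
  finally show ?thesis .
qed

section \<open>Signal strength below the threshold\<close>

lemma cosh_le_one_plus_square:
  fixes x :: real
  assumes "0 \<le> x" "x \<le> 1"
  shows "cosh x \<le> 1 + x\<^sup>2"
proof -
  have "exp (- x) \<le> 1 / (1 + x)"
    using assms exp_ge_add_one_self[of x] by (simp add: exp_minus divide_simps)
  also have "\<dots> \<le> 1 - x + x\<^sup>2"
  proof -
    have "1 \<le> (1 - x + x\<^sup>2) * (1 + x)"
      using assms by (simp add: power2_eq_square algebra_simps)
    then show ?thesis using assms by (simp add: divide_le_eq)
  qed
  finally have "exp (- x) \<le> 1 - x + x\<^sup>2" .
  with exp_bound[OF assms] show ?thesis
    by (simp add: cosh_field_def)
qed

lemma sinh_le_double: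
  fixes x :: real
  assumes "0 \<le> x" "x \<le> 1"
  shows "sinh x \<le> 2 * x"
proof -
  have "x\<^sup>2 \<le> x" using assms by (simp add: power2_eq_square mult_left_le)
  then show ?thesis
    using exp_bound[OF assms] exp_ge_add_one_self[of "- x"] assms by (simp add: sinh_field_def)
qed

text \<open>
  To leading order the second summand is \<open>6 * a\<^sup>2 * p * b\<close> with \<open>b \<le> a\<^sup>2 * n\<close>, that is
  \<open>6 * a ^ 4 * p * n\<close>. The crude estimates \<open>2\<close> for the power of \<open>cosh\<close>, \<open>2 * a\<^sup>2\<close> for \<open>sinh\<close> and
  \<open>2 * b\<close> for the last factor lose a factor of eight, which the constant \<open>1 / 256\<close> absorbs.
\<close>

lemma flip_distance_bound:
  fixes a :: real
  assumes n: "1 \<le> n" "n \<le> p" and a: "a ^ 4 * real p * real n \<le> 1 / 256"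
  defines "b \<equiv> a\<^sup>2 * real (n - 1)"
  shows "1 / 4 + 6 * cosh (a\<^sup>2) ^ p * sinh (a\<^sup>2) * (real p * (2 * (exp (b / 2) * cosh b - 1))) \<le> 1 / 2"
proof -
  have a4: "a ^ 4 = a\<^sup>2 * a\<^sup>2" by (simp add: power2_eq_square power4_eq_xxxx)
  \<comment> \<open>Here \<open>n \<le> p\<close> turns the smallness of \<open>a ^ 4 * p * n\<close> into that of \<open>a\<^sup>2 * n\<close>.\<close>
  have "(a\<^sup>2 * real n)\<^sup>2 = a ^ 4 * real n * real n"
    unfolding a4 by (simp add: power2_eq_square)
  also have "\<dots> \<le> a ^ 4 * real p * real n"
    using n by (intro mult_right_mono mult_left_mono) auto
  also have "\<dots> \<le> (1 / 16)\<^sup>2" using a by (simp add: power2_eq_square)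
  finally have an: "a\<^sup>2 * real n \<le> 1 / 16"
    by (rule power2_le_imp_le) simp
  have b0: "0 \<le> b" by (simp add: b_def)
  have bn: "b \<le> a\<^sup>2 * real n"
    unfolding b_def by (intro mult_left_mono) auto
  have a2: "a\<^sup>2 \<le> 1"
  proof -
    have "a\<^sup>2 * 1 \<le> a\<^sup>2 * real n" using n by (intro mult_left_mono) auto
    then show ?thesis using an by simp
  qed
  have "2 * (exp (b / 2) * cosh b - 1) = exp (3 * b / 2) + exp (- b / 2) - 2"
    by (simp add: cosh_field_def distrib_left exp_add[symmetric] add_divide_distrib[symmetric])
  also have "\<dots> \<le> 3 * b / 2 + (3 * b / 2)\<^sup>2"
  proof -
    have "exp (- b / 2) \<le> 1" using b0 by simp
    moreover have "exp (3 * b / 2) \<le> 1 + 3 * b / 2 + (3 * b / 2)\<^sup>2"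
      using b0 bn an by (intro exp_bound) auto
    ultimately show ?thesis by linarith
  qed
  also have "\<dots> \<le> 2 * b"
  proof -
    have "b * b \<le> b * (1 / 16)" using b0 bn an by (intro mult_left_mono) auto
    then show ?thesis using b0 by (simp add: power2_eq_square)
  qed
  finally have score: "2 * (exp (b / 2) * cosh b - 1) \<le> 2 * (a\<^sup>2 * real n)"
    using bn by simp
  have score0: "0 \<le> 2 * (exp (b / 2) * cosh b - 1)"
  proof -
    have "1 * 1 \<le> exp (b / 2) * cosh b"
      using b0 by (intro mult_mono) (auto simp: cosh_real_ge_1)
    then show ?thesis by simp
  qed
  have "cosh (a\<^sup>2) ^ p \<le> exp (a ^ 4) ^ p"
  proof (intro power_mono)
    have "cosh (a\<^sup>2) \<le> 1 + (a\<^sup>2)\<^sup>2" using a2 by (intro cosh_le_one_plus_square) auto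
    also have "\<dots> \<le> exp ((a\<^sup>2)\<^sup>2)" by (rule exp_ge_add_one_self)
    finally show "cosh (a\<^sup>2) \<le> exp (a ^ 4)" by simp
  qed simp
  also have "\<dots> = exp (a ^ 4 * real p)"
    by (simp add: exp_of_nat_mult[symmetric] mult.commute)
  also have "\<dots> \<le> 2"
  proof -
    have "a ^ 4 * real p * 1 \<le> a ^ 4 * real p * real n"
      using n by (intro mult_left_mono) auto
    then show ?thesis using exp_bound_half[of "a ^ 4 * real p"] a by simp
  qed
  finally have C: "cosh (a\<^sup>2) ^ p \<le> 2" .
  have S: "sinh (a\<^sup>2) \<le> 2 * a\<^sup>2"
    using a2 by (intro sinh_le_double) auto
  have "6 * cosh (a\<^sup>2) ^ p * sinh (a\<^sup>2) * (real p * (2 * (exp (b / 2) * cosh b - 1))) \<le>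
      6 * 2 * (2 * a\<^sup>2) * (real p * (2 * (a\<^sup>2 * real n)))"
  proof (rule mult_mono)
    show "6 * cosh (a\<^sup>2) ^ p * sinh (a\<^sup>2) \<le> 6 * 2 * (2 * a\<^sup>2)"
      by (rule mult_mono) (use C S in auto)
    show "real p * (2 * (exp (b / 2) * cosh b - 1)) \<le> real p * (2 * (a\<^sup>2 * real n))"
      using score by (rule mult_left_mono) simp
    show "0 \<le> real p * (2 * (exp (b / 2) * cosh b - 1))"
      by (rule mult_nonneg_nonneg[OF _ score0]) simp
  qed simp
  also have "\<dots> = 48 * (a ^ 4 * real p * real n)"
  proof -
    have "6 * 2 * (2 * x) * (q * (2 * (x * m))) = 48 * (x * x * q * m)" for x q m :: real by simp
    then show ?thesis unfolding a4 .
  qed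
  also have "\<dots> \<le> 1 / 4" using a by simp
  finally show ?thesis by simp
qed

section \<open>Bayes risk and minimax risk\<close>

lemma marginal_likelihood_flip_integral_bound:
  fixes a :: real
  assumes n: "1 \<le> n" "n \<le> p" and a: "a ^ 4 * real p * real n \<le> 1 / 256"
    and l: "l \<in> labelings n" and k: "k < n"
  defines "l' \<equiv> l(k := - l k)"
  shows "(\<integral>Y. \<bar>marginal_likelihood p {..<n} a l Y - marginal_likelihood p {..<n} a l' Y\<bar> \<partial>noise_law p n) \<le> 1 / 2"
proof -
  have I: "insert k ({..<n} - {k}) = {..<n}" "card ({..<n} - {k}) = n - 1"
    using k by auto
  have l': "l' i \<in> {-1, 1}" if "i < n" for i
    using labelings_sign[OF l that] by (auto simp: l'_def)
  let ?D = "\<lambda>Y. \<bar>marginal_likelihood p {..<n} a l Y - marginal_likelihood p {..<n} a l' Y\<bar>"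
  have "integrable (noise_law p n) ?D"
    using marginal_likelihood_integral[of "{..<n}" l p a] marginal_likelihood_integral[of "{..<n}" l' p a]
      labelings_sign[OF l] l'
    unfolding noise_law_def by (auto simp: has_bochner_integral_iff)
  moreover have "(\<integral>\<^sup>+Y. ennreal (?D Y) \<partial>noise_law p n) \<le> ennreal (1 / 2)"
  proof -
    have "(\<integral>\<^sup>+Y. ennreal (?D Y) \<partial>noise_law p n) \<le>
        ennreal (1 / 4 + 6 * cosh (a\<^sup>2) ^ p * sinh (a\<^sup>2) *
          (real p * (2 * (exp (a\<^sup>2 * real (n - 1) / 2) * cosh (a\<^sup>2 * real (n - 1)) - 1))))"
      using marginal_likelihood_flip_L1_dist[of "{..<n} - {k}" k l p a] labelings_sign[OF l] k
      unfolding noise_law_def I l'_def by auto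
    also have "\<dots> \<le> ennreal (1 / 2)"
      by (intro ennreal_leI flip_distance_bound n a)
    finally show ?thesis .
  qed
  ultimately have "ennreal (\<integral>Y. ?D Y \<partial>noise_law p n) \<le> ennreal (1 / 2)"
    by (subst (asm) nn_integral_eq_integral) auto
  then show ?thesis by (rule ennreal_le_iff[THEN iffD1, rotated]) simp
qed

lemma estimator_measurable:
  assumes "est \<in> estimators p n"
  shows "(\<lambda>Y. f (est Y) :: real) \<in> borel_measurable (noise_law p n)"
proof -
  have "est \<in> noise_law p n \<rightarrow>\<^sub>M count_space (labelings n)"
    using assms unfolding estimators_def measurable_cong_sets[OF sets_noise_law refl] .
  then show ?thesis by (rule measurable_compose) simp
qed

lemma estimator_sign:
  assumes "est \<in> estimators p n" "Y \<in> space (noise_law p n)" "i < n"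
  shows "est Y i \<in> {-1, 1}"
proof -
  have "est Y \<in> space (count_space (labelings n))"
    using assms(1,2) sets_eq_imp_space_eq[OF sets_noise_law, of p n]
    unfolding estimators_def by (intro measurable_space[of est "sample_space p n"]) auto
  then show ?thesis using labelings_sign[OF _ assms(3)] by simp
qed

text \<open>
  Flipping \<open>l k\<close> is an involution of the labelings that negates \<open>l i * l k\<close>. The estimate of this
  product is therefore wrong for exactly one of \<open>l\<close> and its flip, so that the two error integrals
  together are at least the integral of the minimum of the two marginal likelihoods, which equals one
  minus half their \<open>L\<^sup>1\<close> distance.
\<close>

lemma pair_error_lower_bound:
  fixes a :: real
  assumes n: "1 \<le> n" "n \<le> p" and a: "a ^ 4 * real p * real n \<le> 1 / 256"
    and est: "est \<in> estimators p n" and ik: "i < n" "k < n" "i \<noteq> k"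
  shows "2 ^ n * (3 / 8) \<le> (\<Sum>l\<in>labelings n. \<integral>Y. of_bool (est Y i * est Y k \<noteq> l i * l k) *
    marginal_likelihood p {..<n} a l Y \<partial>noise_law p n)"
proof -
  let ?N = "noise_law p n"
  let ?P = "\<lambda>l. marginal_likelihood p {..<n} a l"
  define E where "E l Y = (of_bool (est Y i * est Y k \<noteq> l i * l k) :: real)" for l :: "nat \<Rightarrow> real" and Y
  define F where "F l = l(k := - l k)" for l :: "nat \<Rightarrow> real"
  define g where "g l = (\<integral>Y. E l Y * ?P l Y \<partial>?N)" for l
  have F: "F l \<in> labelings n" if "l \<in> labelings n" for l
    using that ik labelings_sign[OF that ik(2)] by (auto simp: F_def labelings_def PiE_iff extensional_def)
  have FF: "F (F l) = l" for l by (auto simp: F_def)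
  have P: "has_bochner_integral ?N (?P l) 1" if "l \<in> labelings n" for l
    unfolding noise_law_def using labelings_sign[OF that] by (intro marginal_likelihood_integral) auto
  have E_meas: "E l \<in> borel_measurable ?N" for l
    unfolding E_def by (rule estimator_measurable[OF est, where f="\<lambda>e. of_bool (e i * e k \<noteq> l i * l k)"])
  have EP: "integrable ?N (\<lambda>Y. E l Y * ?P l Y)" if "l \<in> labelings n" for l
  proof (rule Bochner_Integration.integrable_bound)
    show "integrable ?N (?P l)" using P[OF that] by (simp add: has_bochner_integral_iff)
    then show "(\<lambda>Y. E l Y * ?P l Y) \<in> borel_measurable ?N" using E_meas by auto
    show "AE Y in ?N. norm (E l Y * ?P l Y) \<le> norm (?P l Y)"
      by (auto simp: E_def)
  qed
  have pair: "3 / 4 \<le> g l + g (F l)" if l: "l \<in> labelings n" for l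
  proof -
    note P1 = P[OF l] and P2 = P[OF F[OF l]]
    have D: "integrable ?N (\<lambda>Y. \<bar>?P l Y - ?P (F l) Y\<bar>)"
      using P1 P2 by (auto simp: has_bochner_integral_iff)
    have "(\<integral>Y. \<bar>?P l Y - ?P (F l) Y\<bar> \<partial>?N) \<le> 1 / 2"
      unfolding F_def by (rule marginal_likelihood_flip_integral_bound[OF n a l ik(2)])
    then have "3 / 4 \<le> (\<integral>Y. (?P l Y + ?P (F l) Y - \<bar>?P l Y - ?P (F l) Y\<bar>) / 2 \<partial>?N)"
      using P1 P2 D by (simp add: has_bochner_integral_iff)
    also have "\<dots> \<le> (\<integral>Y. E l Y * ?P l Y + E (F l) Y * ?P (F l) Y \<partial>?N)"
    proof (rule integral_mono)
      fix Y assume Y: "Y \<in> space ?N"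
      have "est Y i * est Y k \<in> {-1, 1}" "l i * l k \<in> {-1, 1}"
        using estimator_sign[OF est Y ik(1)] estimator_sign[OF est Y ik(2)]
          labelings_sign[OF l ik(1)] labelings_sign[OF l ik(2)] by auto
      moreover have "F l i * F l k = - (l i * l k)"
        using ik by (simp add: F_def)
      ultimately have "E (F l) Y = 1 - E l Y" "E l Y = 0 \<or> E l Y = 1"
        by (auto simp: E_def)
      then show "(?P l Y + ?P (F l) Y - \<bar>?P l Y - ?P (F l) Y\<bar>) / 2 \<le> E l Y * ?P l Y + E (F l) Y * ?P (F l) Y"
        by auto
    qed (use P1 P2 D EP[OF l] EP[OF F[OF l]] in \<open>auto simp: has_bochner_integral_iff\<close>)
    also have "\<dots> = g l + g (F l)"
      unfolding g_def using EP[OF l] EP[OF F[OF l]] by (rule Bochner_Integration.integral_add)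
    finally show ?thesis .
  qed
  have reindex: "(\<Sum>l\<in>labelings n. g (F l)) = (\<Sum>l\<in>labelings n. g l)"
    by (rule sum.reindex_bij_witness[where i=F and j=F]) (auto simp: FF F)
  have "2 ^ n * (3 / 4) = (\<Sum>l\<in>labelings n. 3 / 4 :: real)"
    by (simp add: card_labelings)
  also have "\<dots> \<le> (\<Sum>l\<in>labelings n. g l + g (F l))"
    by (intro sum_mono pair)
  also have "\<dots> = 2 * (\<Sum>l\<in>labelings n. g l)"
    by (simp add: sum.distrib reindex)
  finally show ?thesis
    by (simp add: g_def E_def)
qed

lemma risk_eq_likelihood_integral:
  assumes est: "est \<in> estimators p n"
  shows "risk p n est \<mu> l =
    (\<integral>Y. likelihood p {..<n} \<mu> l Y * misclassification_rate n (est Y) l \<partial>noise_law p n)"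
proof -
  have "likelihood p {..<n} \<mu> l \<in> borel_measurable (noise_law p n)"
    unfolding likelihood_def noise_law_def by measurable
  moreover have "(\<lambda>Y. misclassification_rate n (est Y) l) \<in> borel_measurable (noise_law p n)"
    by (rule estimator_measurable[OF est, where f="\<lambda>e. misclassification_rate n e l"])
  ultimately show ?thesis
    unfolding risk_def observation_law_eq_density
    by (subst integral_density) (auto simp: likelihood_def tilt_def intro!: prod_nonneg)
qed

lemma risk_le_1:
  assumes est: "est \<in> estimators p n"
  shows "risk p n est \<mu> l \<le> 1"
proof -
  let ?N = "noise_law p n"
  interpret N: prob_space ?N
    unfolding noise_law_def by (intro prob_space_PiM prob_space_std_gaussian)
  have "(\<lambda>Z. Z i j) \<in> borel_measurable ?N" if "i < n" "j < p" for i j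
    unfolding measurable_cong_sets[OF sets_noise_law refl] sample_space_def
    using that by (intro measurable_compose[where f="\<lambda>Z. Z i" and g="\<lambda>y. y j" and N="\<Pi>\<^sub>M j\<in>{..<p}. borel"]
        measurable_component_singleton) auto
  then have "observation p n \<mu> l \<in> ?N \<rightarrow>\<^sub>M sample_space p n"
    unfolding observation_def sample_space_def
    by (intro measurable_restrict borel_measurable_add borel_measurable_const) auto
  then interpret O: prob_space "observation_law p n \<mu> l"
    unfolding observation_law_def by (rule N.prob_space_distr)
  have sets_eq: "sets (observation_law p n \<mu> l) = sets ?N"
    by (simp add: observation_law_eq_density)
  have "(\<lambda>Y. misclassification_rate n (est Y) l) \<in> borel_measurable (observation_law p n \<mu> l)"
    unfolding measurable_cong_sets[OF sets_eq refl]
    by (rule estimator_measurable[OF est, where f="\<lambda>e. misclassification_rate n e l"])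
  then have "integrable (observation_law p n \<mu> l) (\<lambda>Y. misclassification_rate n (est Y) l)"
    by (intro O.integrable_const_bound[where B=1]) (auto simp: misclassification_rate_bounds)
  then show ?thesis
    unfolding risk_def by (intro O.integral_le_const) (auto simp: misclassification_rate_bounds)
qed

text \<open>
  Summing the risk over \<open>\<epsilon>\<close> turns the likelihood into the marginal likelihood. The misclassification
  rate is then bounded below by the pair errors, of which the \<open>n * (n - 1)\<close> off-diagonal pairs
  contribute \<open>3 / 8\<close> each on average over the labelings.
\<close>

lemma bayes_risk_lower_bound:
  fixes a :: real
  assumes n: "3 \<le> n" "n \<le> p" and a: "a ^ 4 * real p * real n \<le> 1 / 256"
    and est: "est \<in> estimators p n"
  shows "2 ^ p * 2 ^ n * (1 / 8) \<le>
    (\<Sum>l\<in>labelings n. \<Sum>\<epsilon>\<in>labelings p. risk p n est (\<lambda>j\<in>{..<p}. a * \<epsilon> j) l)"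
proof -
  let ?N = "noise_law p n"
  let ?P = "\<lambda>l. marginal_likelihood p {..<n} a l"
  let ?M = "\<lambda>l Y. misclassification_rate n (est Y) l"
  define E where "E i k l Y = (of_bool (est Y i * est Y k \<noteq> l i * l k) :: real)"
    for i k and l :: "nat \<Rightarrow> real" and Y
  have bounded_integrable: "integrable ?N (\<lambda>Y. f (est Y) * q Y)"
    if f: "\<And>e. \<bar>f e\<bar> \<le> (1::real)" and q: "integrable ?N q" for f q
  proof (rule Bochner_Integration.integrable_bound[OF q])
    show "(\<lambda>Y. f (est Y) * q Y) \<in> borel_measurable ?N"
      using estimator_measurable[OF est, of f] q by auto
    show "AE Y in ?N. norm (f (est Y) * q Y) \<le> norm (q Y)"
      using f by (intro AE_I2) (simp add: abs_mult mult_left_le_one_le)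
  qed
  have L: "integrable ?N (likelihood p {..<n} (\<lambda>j. a * \<epsilon> j) l)"
    if "l \<in> labelings n" "\<epsilon> \<in> labelings p" for l \<epsilon>
    using likelihood_integral[of "{..<n}" l \<epsilon> p a] labelings_sign[OF that(1)] that(2)
    unfolding noise_law_def by (auto simp: has_bochner_integral_iff)
  have P: "integrable ?N (?P l)" if "l \<in> labelings n" for l
    using marginal_likelihood_integral[of "{..<n}" l p a] labelings_sign[OF that]
    unfolding noise_law_def by (auto simp: has_bochner_integral_iff)
  have EP: "integrable ?N (\<lambda>Y. E i k l Y * ?P l Y)" if "l \<in> labelings n" for i k l
    unfolding E_def
    by (rule bounded_integrable[where f="\<lambda>e. of_bool (e i * e k \<noteq> l i * l k)", OF _ P[OF that]]) auto
  have MP: "integrable ?N (\<lambda>Y. ?M l Y * ?P l Y)" if "l \<in> labelings n" for l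
    by (rule bounded_integrable[where f="\<lambda>e. misclassification_rate n e l", OF _ P[OF that]])
      (auto simp: misclassification_rate_bounds abs_le_iff intro: order_trans[OF _ misclassification_rate_bounds(1)])
  have mean_risk: "(\<Sum>\<epsilon>\<in>labelings p. risk p n est (\<lambda>j\<in>{..<p}. a * \<epsilon> j) l) =
      2 ^ p * (\<integral>Y. ?M l Y * ?P l Y \<partial>?N)" if l: "l \<in> labelings n" for l
  proof -
    have "likelihood p {..<n} (\<lambda>j\<in>{..<p}. a * \<epsilon> j) l = likelihood p {..<n} (\<lambda>j. a * \<epsilon> j) l" for \<epsilon>
      by (simp add: likelihood_def tilt_def fun_eq_iff)
    then have "(\<Sum>\<epsilon>\<in>labelings p. risk p n est (\<lambda>j\<in>{..<p}. a * \<epsilon> j) l) =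
        (\<Sum>\<epsilon>\<in>labelings p. \<integral>Y. ?M l Y * likelihood p {..<n} (\<lambda>j. a * \<epsilon> j) l Y \<partial>?N)"
      by (simp add: risk_eq_likelihood_integral[OF est] mult.commute)
    also have "\<dots> = (\<integral>Y. (\<Sum>\<epsilon>\<in>labelings p. ?M l Y * likelihood p {..<n} (\<lambda>j. a * \<epsilon> j) l Y) \<partial>?N)"
    proof (rule Bochner_Integration.integral_sum[symmetric])
      fix \<epsilon> assume "\<epsilon> \<in> labelings p"
      then show "integrable ?N (\<lambda>Y. ?M l Y * likelihood p {..<n} (\<lambda>j. a * \<epsilon> j) l Y)"
        by (intro bounded_integrable[where f="\<lambda>e. misclassification_rate n e l"] L l)
          (auto simp: misclassification_rate_bounds abs_le_iff intro: order_trans[OF _ misclassification_rate_bounds(1)])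
    qed
    also have "\<dots> = (\<integral>Y. 2 ^ p * (?M l Y * ?P l Y) \<partial>?N)"
      by (intro Bochner_Integration.integral_cong refl)
        (simp add: marginal_likelihood_def sum_distrib_left[symmetric])
    finally show ?thesis by simp
  qed
  have pairs: "(\<Sum>i<n. \<Sum>k<n. \<integral>Y. E i k l Y * ?P l Y \<partial>?N) \<le> 2 * (real n)\<^sup>2 * (\<integral>Y. ?M l Y * ?P l Y \<partial>?N)"
    if l: "l \<in> labelings n" for l
  proof -
    have "(\<Sum>i<n. \<Sum>k<n. \<integral>Y. E i k l Y * ?P l Y \<partial>?N) = (\<integral>Y. (\<Sum>i<n. \<Sum>k<n. E i k l Y * ?P l Y) \<partial>?N)"
      using EP[OF l] by (simp add: Bochner_Integration.integral_sum)
    also have "\<dots> \<le> (\<integral>Y. 2 * (real n)\<^sup>2 * (?M l Y * ?P l Y) \<partial>?N)"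
    proof (rule integral_mono)
      fix Y assume Y: "Y \<in> space ?N"
      have "(\<Sum>i<n. \<Sum>k<n. E i k l Y) \<le> 2 * (real n)\<^sup>2 * ?M l Y"
        unfolding E_def
        by (intro pair_errors_le_misclassification labelings_sign[OF l] estimator_sign[OF est Y])
      from mult_right_mono[OF this marginal_likelihood_nonneg]
      show "(\<Sum>i<n. \<Sum>k<n. E i k l Y * ?P l Y) \<le> 2 * (real n)\<^sup>2 * (?M l Y * ?P l Y)"
        by (simp add: sum_distrib_right mult.assoc)
    qed (use EP[OF l] MP[OF l] in auto)
    finally show ?thesis by simp
  qed
  \<comment> \<open>This is \<open>2 * n \<le> 3 * (n - 1)\<close> after scaling; it needs \<open>n \<ge> 3\<close>.\<close>
  have "(real n)\<^sup>2 * (2 ^ n * (1 / 4)) \<le> real n * (real n - 1) * (2 ^ n * (3 / 8))"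
  proof -
    have "real n * real n * 2 \<le> real n * (real n - 1) * 3"
      using n by (simp add: algebra_simps mult_le_cancel_left)
    then have "(real n * real n * 2) * (2 ^ n / 8) \<le> (real n * (real n - 1) * 3) * (2 ^ n / 8)"
      by (intro mult_right_mono) auto
    then show ?thesis by (simp add: power2_eq_square)
  qed
  also have "real n * (real n - 1) * (2 ^ n * (3 / 8)) = (\<Sum>i<n. \<Sum>k\<in>{..<n} - {i}. 2 ^ n * (3 / 8) :: real)"
    using n by (simp add: of_nat_diff)
  also have "\<dots> \<le> (\<Sum>i<n. \<Sum>k\<in>{..<n} - {i}. \<Sum>l\<in>labelings n. \<integral>Y. E i k l Y * ?P l Y \<partial>?N)"
    unfolding E_def using n by (intro sum_mono pair_error_lower_bound a est) auto
  also have "\<dots> \<le> (\<Sum>i<n. \<Sum>k<n. \<Sum>l\<in>labelings n. \<integral>Y. E i k l Y * ?P l Y \<partial>?N)"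
    by (intro sum_mono sum_mono2 sum_nonneg integral_nonneg) (auto simp: E_def marginal_likelihood_nonneg)
  also have "\<dots> = (\<Sum>i<n. \<Sum>l\<in>labelings n. \<Sum>k<n. \<integral>Y. E i k l Y * ?P l Y \<partial>?N)"
    by (intro sum.cong refl sum.swap)
  also have "\<dots> = (\<Sum>l\<in>labelings n. \<Sum>i<n. \<Sum>k<n. \<integral>Y. E i k l Y * ?P l Y \<partial>?N)"
    by (rule sum.swap)
  also have "\<dots> \<le> (\<Sum>l\<in>labelings n. 2 * (real n)\<^sup>2 * (\<integral>Y. ?M l Y * ?P l Y \<partial>?N))"
    by (intro sum_mono pairs)
  also have "\<dots> = (real n)\<^sup>2 * (2 * (\<Sum>l\<in>labelings n. \<integral>Y. ?M l Y * ?P l Y \<partial>?N))"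
    by (simp add: sum_distrib_left mult_ac)
  finally have "2 ^ n * (1 / 4) \<le> 2 * (\<Sum>l\<in>labelings n. \<integral>Y. ?M l Y * ?P l Y \<partial>?N)"
    using n by (simp add: mult_le_cancel_left_pos)
  then have "2 ^ p * (2 ^ n * (1 / 8)) \<le> 2 ^ p * (\<Sum>l\<in>labelings n. \<integral>Y. ?M l Y * ?P l Y \<partial>?N)"
    by (intro mult_left_mono) auto
  also have "\<dots> = (\<Sum>l\<in>labelings n. \<Sum>\<epsilon>\<in>labelings p. risk p n est (\<lambda>j\<in>{..<p}. a * \<epsilon> j) l)"
    by (simp add: mean_risk sum_distrib_left)
  finally show ?thesis by (simp add: mult.assoc)
qed

theorem theorem6:
  "\<exists>(c_gap::real) (C_n::real). c_gap > 0 \<and> C_n > 0 \<and>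
     (\<forall>p n::nat. p \<ge> n \<longrightarrow> real n \<ge> C_n \<longrightarrow>
        minimax_risk p n (c_gap * (real p / real n) powr (1 / 4)) \<ge> 1 / 8)"
proof (rule exI[of _ "1/4"], rule exI[of _ 3], intro conjI allI impI)
  fix p n :: nat
  assume pn: "n \<le> p" and "3 \<le> real n"
  then have n: "3 \<le> n" by simp
  define r where "r = 1 / 4 * (real p / real n) powr (1 / 4)"
  define a where "a = r / sqrt (real p)"
  have r0: "0 \<le> r" by (simp add: r_def)
  have "r ^ 4 = (1 / 4) ^ 4 * ((real p / real n) powr (1 / 4)) ^ 4"
    unfolding r_def by (rule power_mult_distrib)
  also have "((real p / real n) powr (1 / 4)) ^ 4 = real p / real n"
    using n pn by (simp add: powr_power)
  finally have r4: "r ^ 4 = real p / real n / 256" by (simp add: power_divide)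
  have "sqrt (real p) ^ 4 = real p * real p"
    by (simp add: power4_eq_xxxx flip: mult.assoc)
  then have a: "a ^ 4 * real p * real n \<le> 1 / 256"
    using n pn by (simp add: a_def power_divide r4 field_simps)
  have mean: "(\<lambda>j\<in>{..<p}. a * \<epsilon> j) \<in> mean_vectors p r" if "\<epsilon> \<in> labelings p" for \<epsilon>
  proof -
    have "(a * \<epsilon> j)\<^sup>2 = a\<^sup>2" if "j < p" for j
      using labelings_sign[OF \<open>\<epsilon> \<in> labelings p\<close> that] by (auto simp: power_mult_distrib)
    then have "L2_set (\<lambda>j\<in>{..<p}. a * \<epsilon> j) {..<p} = sqrt (real p * a\<^sup>2)"
      by (simp add: L2_set_def)
    also have "\<dots> = r"
      using n pn r0 by (simp add: a_def power_divide)
    finally show ?thesis by (simp add: mean_vectors_def)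
  qed
  have "(\<lambda>_. \<lambda>i\<in>{..<n}. 1) \<in> estimators p n"
    by (simp add: estimators_def labelings_def)
  then have "estimators p n \<noteq> {}" by blast
  then show "1 / 8 \<le> minimax_risk p n (1 / 4 * (real p / real n) powr (1 / 4))"
    unfolding minimax_risk_def r_def[symmetric]
  proof (rule cINF_greatest)
    fix est assume est: "est \<in> estimators p n"
    let ?sup = "SUP (\<mu>, l)\<in>mean_vectors p r \<times> labelings n. risk p n est \<mu> l"
    have le_sup: "risk p n est \<mu> l \<le> ?sup" if "\<mu> \<in> mean_vectors p r" "l \<in> labelings n" for \<mu> l
    proof -
      have "bdd_above ((\<lambda>(\<mu>, l). risk p n est \<mu> l) ` (mean_vectors p r \<times> labelings n))"
        by (rule bdd_aboveI[of _ 1]) (auto intro: risk_le_1[OF est])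
      from cSUP_upper[OF _ this, of "(\<mu>, l)"] that show ?thesis by simp
    qed
    have "2 ^ p * 2 ^ n * (1 / 8) \<le>
        (\<Sum>l\<in>labelings n. \<Sum>\<epsilon>\<in>labelings p. risk p n est (\<lambda>j\<in>{..<p}. a * \<epsilon> j) l)"
      by (rule bayes_risk_lower_bound[OF n pn a est])
    also have "\<dots> \<le> (\<Sum>l\<in>labelings n. \<Sum>\<epsilon>\<in>labelings p. ?sup)"
      by (intro sum_mono le_sup mean)
    also have "\<dots> = 2 ^ p * 2 ^ n * ?sup"
      by (simp add: card_labelings)
    finally show "1 / 8 \<le> ?sup"
      by (rule mult_left_le_imp_le) simp
  qed
qed simp_all

end
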